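(* Let $p$ be a nonconstant real polynomial (in one variable). Then the Lipschitz-free spaces over $\{(p(n),p(m)):n,m\in\mathbb{N}\}\subset\mathbb{R}^2$ and over $\mathbb{Z}^2$ are isomorphic: \[\mathcal{F}\left(\{(p(n),p(m)):n,m\in\mathbb{N}\}\right)\sim\mathcal{F}(\mathbb{Z}^2).\]
   Context: $\mathbb{N}=\{1,2,\dots\}$. All Banach spaces are real. For a metric space $M$ with a chosen basepoint $0_M\in M$, $\mathrm{Lip}_0(M)$ is the Banach space of Lipschitz functions $f:M\to\mathbb{R}$ with $f(0_M)=0$, normed by the Lipschitz constant. For $x\in M$, $\delta_M(x)\in\mathrm{Lip}_0(M)^*$ is the evaluation functional $\delta_M(x)(f)=f(x)$. The Lipschitz-free space is $\mathcal{F}(M)=\overline{\mathrm{span}}^{\|\cdot\|}\{\delta_M(x):x\in M\}\subset\mathrm{Lip}_0(M)^*$; up to isometric isomorphism it does not depend on the basepoint. $X\sim Y$ means that the Banach spaces $X$ and $Y$ are linearly isomorphic (via a bounded linear bijection with bounded inverse). Subsets of $\mathbb{R}^2$ carry the metric induced by the norm $\|\cdot\|_\infty$. *)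

theory Defs
  imports
    "HOL-Analysis.Analysis"
    "HOL-Library.Function_Algebras"
    "HOL-Computational_Algebra.Polynomial"
begin

instantiation "fun" :: (type, real_vector) real_vector
begin

definition scaleR_fun_def: "c *\<^sub>R f = (\<lambda>x. c *\<^sub>R f x)"

instance
  by standard
    (simp_all add: scaleR_fun_def fun_eq_iff scaleR_add_right scaleR_add_left)

end

text \<open>
  Spaces such as \<open>Lip\<^sub>0(M)\<close> depend on a set \<open>M\<close> and hence cannot be types. A normed space is
  given as a linear subspace of an ambient real vector space (in practice a function space with
  pointwise operations) together with a norm, which is only meaningful on that subspace.
\<close>

record 'v normed_space =
  vectors :: "'v set"
  nrm :: "'v \<Rightarrow> real"

definition bounded_linear_map ::
  "'v::real_vector normed_space \<Rightarrow> 'w::real_vector normed_space \<Rightarrow> ('v \<Rightarrow> 'w) \<Rightarrow> bool" where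
  "bounded_linear_map V W T \<longleftrightarrow>
     T ` vectors V \<subseteq> vectors W \<and>
     (\<forall>u\<in>vectors V. \<forall>v\<in>vectors V. T (u + v) = T u + T v) \<and>
     (\<forall>c. \<forall>v\<in>vectors V. T (c *\<^sub>R v) = c *\<^sub>R T v) \<and>
     (\<exists>C. \<forall>v\<in>vectors V. nrm W (T v) \<le> C * nrm V v)"

definition isomorphic_spaces ::
  "'v::real_vector normed_space \<Rightarrow> 'w::real_vector normed_space \<Rightarrow> bool" (infix "\<sim>\<^sub>B" 50) where
  "V \<sim>\<^sub>B W \<longleftrightarrow>
     (\<exists>T. bij_betw T (vectors V) (vectors W) \<and> bounded_linear_map V W T \<and>
          bounded_linear_map W V (inv_into (vectors V) T))"

definition real_line :: "real normed_space" where
  "real_line = \<lparr>vectors = UNIV, nrm = abs\<rparr>"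

text \<open>Functionals are extended by \<open>0\<close> outside the space, so that equal functionals are equal
  as HOL functions.\<close>

definition dual_space :: "'v::real_vector normed_space \<Rightarrow> ('v \<Rightarrow> real) normed_space" where
  "dual_space V =
     \<lparr>vectors = {\<phi>. bounded_linear_map V real_line \<phi> \<and> (\<forall>v. v \<notin> vectors V \<longrightarrow> \<phi> v = 0)},
      nrm = (\<lambda>\<phi>. Sup {\<bar>\<phi> v\<bar> | v. v \<in> vectors V \<and> nrm V v \<le> 1})\<rparr>"

definition closed_span :: "'v::real_vector normed_space \<Rightarrow> 'v set \<Rightarrow> 'v normed_space" where
  "closed_span V S =
     \<lparr>vectors = {v \<in> vectors V. \<forall>e>0. \<exists>s\<in>span S. nrm V (v - s) < e}, nrm = nrm V\<rparr>"

definition lipschitz_const :: "'a metric \<Rightarrow> ('a \<Rightarrow> real) \<Rightarrow> real" where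
  "lipschitz_const M f =
     Inf {L. 0 \<le> L \<and> (\<forall>x\<in>mspace M. \<forall>y\<in>mspace M. \<bar>f x - f y\<bar> \<le> L * mdist M x y)}"

text \<open>The second argument is the basepoint. Again, functions on \<open>mspace M\<close> are extended by \<open>0\<close>.\<close>

definition Lip0 :: "'a metric \<Rightarrow> 'a \<Rightarrow> ('a \<Rightarrow> real) normed_space" where
  "Lip0 M z =
     \<lparr>vectors = {f. Lipschitz_continuous_map M euclidean_metric f \<and> f z = 0 \<and>
                    (\<forall>x. x \<notin> mspace M \<longrightarrow> f x = 0)},
      nrm = lipschitz_const M\<rparr>"

definition evaluation :: "'a metric \<Rightarrow> 'a \<Rightarrow> 'a \<Rightarrow> ('a \<Rightarrow> real) \<Rightarrow> real" where
  "evaluation M z x = (\<lambda>f. if f \<in> vectors (Lip0 M z) then f x else 0)"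

definition lipschitz_free_space :: "'a metric \<Rightarrow> 'a \<Rightarrow> (('a \<Rightarrow> real) \<Rightarrow> real) normed_space" where
  "lipschitz_free_space M z = closed_span (dual_space (Lip0 M z)) (evaluation M z ` mspace M)"

definition linf_plane :: "(real \<times> real) metric" where
  "linf_plane = metric (UNIV, \<lambda>x y. infnorm (x - y))"

lemma Metric_space_infnorm:
  "Metric_space UNIV (\<lambda>x y::'a::euclidean_space. infnorm (x - y))"
proof
  fix x y z :: 'a
  show "infnorm (x - z) \<le> infnorm (x - y) + infnorm (y - z)"
    using infnorm_triangle[of "x - y" "y - z"] by simp
qed (auto simp: infnorm_pos_le infnorm_sub infnorm_eq_0)

lemma mspace_linf_plane [simp]: "mspace linf_plane = UNIV"
  unfolding linf_plane_def by (rule Metric_space.mspace_metric[OF Metric_space_infnorm])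

lemma mdist_linf_plane: "mdist linf_plane (a, b) (c, d) = max \<bar>a - c\<bar> \<bar>b - d\<bar>"
proof -
  have basis: "(Basis :: (real \<times> real) set) = {(1, 0), (0, 1)}"
    by (auto simp: Basis_prod_def)
  have "{\<bar>(a - c, b - d) \<bullet> i\<bar> | i. i \<in> Basis} = {\<bar>a - c\<bar>, \<bar>b - d\<bar>}"
    unfolding Setcompr_eq_image basis by simp
  then show ?thesis
    unfolding linf_plane_def Metric_space.mdist_metric[OF Metric_space_infnorm]
    by (simp add: infnorm_def cSup_eq_Max)
qed

definition poly_grid :: "real poly \<Rightarrow> (real \<times> real) set" where
  "poly_grid p = {(poly p (real n), poly p (real m)) | n m. 1 \<le> n \<and> 1 \<le> m}"

end

theory Submission
  imports Defs
begin

text \<open>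
  Why the theorem holds. Instead of the free spaces one compares their duals, the spaces
  \<open>Lip\<^sub>0\<close>. An isomorphism between two such function spaces is the adjoint of an isomorphism of the free
  spaces as soon as it and its inverse are bounded and weak-star continuous. All operators needed
  here are \<^emph>\<open>row finite\<close>: each value of the image function is a fixed finite linear combination of
  values of the argument. This makes weak-star continuity automatic, and
  \<open>free_space_iso\<close> turns a pair of mutually inverse bounded row finite operators into an isomorphism of
  the free spaces.

  Let \<open>A = {a\<^sub>0 < a\<^sub>1 < \<dots>}\<close> be the sorted set of values of the polynomial, up to a sign. On \<open>A \<times> A\<close> a
  function is Lipschitz if and only if its increments along the edges of the grid are bounded by a
  multiple of the gaps \<open>a\<^sub>i\<^sub>+\<^sub>1 - a\<^sub>i\<close>. So \<open>Lip\<^sub>0(A \<times> A)\<close> is a space of functions on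
  \<open>\<int> \<times> \<int>\<close> determined by a weight for the edges (\<open>grid w\<close>), and \<open>Lip\<^sub>0(\<int> \<times> \<int>)\<close> is the case of the weight 1.
  Both are shown to be isomorphic to \<open>blocks\<close>, the bounded families of
  Lipschitz functions on finite squares of lattice points, in which every side length occurs infinitely
  often. This space is isomorphic to its own countable \<open>\<ell>\<^sub>\<infinity>\<close>-power, so by Pelczynski's decomposition
  method (\<open>pelczynski_decomposition\<close>) three complementation statements are enough:

  \<^item> \<open>grid 1\<close> is complemented in \<open>blocks\<close> (\<open>grid_complemented_in_blocks\<close>): restrict a function to
    the squares, and glue the restrictions to squares of side about \<open>2^k\<close> with a partition of unity
    subordinate to dyadic annuli.

  \<^item> \<open>grid w\<close> is complemented in \<open>grid 1\<close> for positive integer weights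
    (\<open>weighted_grid_complemented\<close>): rounding up the gaps changes the norm only up to equivalence,
    \<open>A\<close> becomes a set of integers, and bilinear interpolation extends Lipschitz functions from \<open>A \<times> A\<close> to
    \<open>\<int> \<times> \<int>\<close> linearly.

  \<^item> \<open>blocks\<close> is complemented in \<open>grid w\<close> (\<open>blocks_complemented_in_grid\<close>) if there are arbitrarily
    long intervals, arbitrarily far out, on which \<open>w\<close> is constant up to a fixed factor. Rescaled
    squares are placed along the diagonal over disjoint such intervals. Each function on a
    square extends to the plane by clamping the coordinates, and an edge of the grid sees
    at most one of these extensions change, so the sum of all of them is Lipschitz.

  The gaps of the values of a polynomial of degree \<open>e + 1\<close> are comparable with \<open>n\<^sup>e\<close>, and \<open>(2 n)\<^sup>e / n\<^sup>e\<close>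
  is bounded; this gives the last condition (\<open>poly_values_enumeration\<close>).
\<close>

section \<open>Row finite operators and function spaces given by their balls\<close>

text \<open>The functionals on functions that are finite linear combinations of point evaluations.\<close>

definition finite_functionals :: "(('a \<Rightarrow> real) \<Rightarrow> real) set" where
  "finite_functionals = span (range (\<lambda>x f. f x))"

lemma finite_functional_eval: "(\<lambda>f. f x) \<in> finite_functionals"
  unfolding finite_functionals_def by (rule span_base) simp

lemma finite_functional_zero: "(\<lambda>f. 0) \<in> finite_functionals"
  using span_zero[of "range (\<lambda>x f. f x)"] unfolding finite_functionals_def zero_fun_def .

lemma finite_functional_add:
  assumes "\<phi> \<in> finite_functionals" "\<psi> \<in> finite_functionals"
  shows "(\<lambda>f. \<phi> f + \<psi> f) \<in> finite_functionals"
  using span_add[OF assms[unfolded finite_functionals_def]]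
  unfolding finite_functionals_def plus_fun_def .

lemma finite_functional_diff:
  assumes "\<phi> \<in> finite_functionals" "\<psi> \<in> finite_functionals"
  shows "(\<lambda>f. \<phi> f - \<psi> f) \<in> finite_functionals"
  using span_diff[OF assms[unfolded finite_functionals_def]]
  unfolding finite_functionals_def fun_diff_def .

lemma finite_functional_scale:
  assumes "\<phi> \<in> finite_functionals"
  shows "(\<lambda>f. c * \<phi> f) \<in> finite_functionals"
  using span_scale[OF assms[unfolded finite_functionals_def], of c]
  unfolding finite_functionals_def scaleR_fun_def by simp

lemma finite_functional_divide:
  assumes "\<phi> \<in> finite_functionals"
  shows "(\<lambda>f. \<phi> f / c) \<in> finite_functionals"
  using finite_functional_scale[OF assms, of "1 / c"] by simp

lemma finite_functional_sum:
  assumes "\<And>i. i \<in> I \<Longrightarrow> \<phi> i \<in> finite_functionals"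
  shows "(\<lambda>f. \<Sum>i\<in>I. \<phi> i f) \<in> finite_functionals"
  using assms
  by (induction I rule: infinite_finite_induct)
    (auto intro: finite_functional_zero finite_functional_add)

lemmas finite_functional_intros = finite_functional_eval finite_functional_zero
  finite_functional_add finite_functional_diff finite_functional_scale
  finite_functional_divide finite_functional_sum

lemma finite_functional_linear:
  assumes "\<phi> \<in> finite_functionals"
  shows "\<phi> (f + g) = \<phi> f + \<phi> g" "\<phi> (f - g) = \<phi> f - \<phi> g" "\<phi> (c *\<^sub>R f) = c * \<phi> f"
proof -
  have "\<phi> (f + g) = \<phi> f + \<phi> g \<and> \<phi> (f - g) = \<phi> f - \<phi> g \<and> \<phi> (c *\<^sub>R f) = c * \<phi> f"
    using assms unfolding finite_functionals_def
    by (induction rule: span_induct_alt)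
      (auto simp: scaleR_fun_def algebra_simps)
  then show "\<phi> (f + g) = \<phi> f + \<phi> g" "\<phi> (f - g) = \<phi> f - \<phi> g" "\<phi> (c *\<^sub>R f) = c * \<phi> f"
    by auto
qed

text \<open>Every value of \<open>T f\<close> is a finite linear combination of values of \<open>f\<close>. The condition is imposed on
  all functions, not only on a space on which \<open>T\<close> is bounded, so \<open>T\<close> is linear everywhere.\<close>

definition row_finite :: "(('a \<Rightarrow> real) \<Rightarrow> ('b \<Rightarrow> real)) \<Rightarrow> bool" where
  "row_finite T \<longleftrightarrow> (\<forall>x. (\<lambda>f. T f x) \<in> finite_functionals)"

lemma row_finite_linear:
  assumes "row_finite T"
  shows "T (f + g) = T f + T g" "T (f - g) = T f - T g" "T (c *\<^sub>R f) = c *\<^sub>R T f"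
  using finite_functional_linear[OF assms[unfolded row_finite_def, rule_format]]
  by (auto simp: fun_eq_iff scaleR_fun_def)

lemma finite_functional_comp:
  assumes "\<phi> \<in> finite_functionals" "row_finite T"
  shows "(\<lambda>f. \<phi> (T f)) \<in> finite_functionals"
  using assms(1) unfolding finite_functionals_def
proof (induction rule: span_induct_alt)
  case base
  then show ?case using finite_functional_zero by (simp add: finite_functionals_def)
next
  case (step c \<psi> \<phi>)
  then obtain x where "\<psi> = (\<lambda>f. f x)" by auto
  then have "(\<lambda>f. c * \<psi> (T f) + \<phi> (T f)) \<in> finite_functionals"
    using step assms(2)
    by (auto simp: row_finite_def finite_functionals_def[symmetric] intro!: finite_functional_intros)
  then show ?case by (simp add: finite_functionals_def scaleR_fun_def)
qed

lemma row_finite_comp: "row_finite S \<Longrightarrow> row_finite T \<Longrightarrow> row_finite (\<lambda>f. S (T f))"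
  unfolding row_finite_def[of S] row_finite_def[of "\<lambda>f. S (T f)"]
  using finite_functional_comp[of "\<lambda>f. S f x" T for x] by simp

text \<open>A normed space of functions is encoded by its closed balls about \<open>0\<close>: \<open>V C f\<close> says that \<open>f\<close> belongs to the
  space and has norm at most \<open>C\<close>. The conditions collected here are those that make sums
  and differences of bounded operators bounded.\<close>

definition ball_family :: "(real \<Rightarrow> ('a \<Rightarrow> real) \<Rightarrow> bool) \<Rightarrow> bool" where
  "ball_family V \<longleftrightarrow>
     (\<forall>C f. V C f \<longrightarrow> 0 \<le> C) \<and>
     (\<forall>C D f. V C f \<longrightarrow> C \<le> D \<longrightarrow> V D f) \<and>
     (\<forall>C D f g. V C f \<longrightarrow> V D g \<longrightarrow> V (C + D) (f + g)) \<and>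
     (\<forall>C D f g. V C f \<longrightarrow> V D g \<longrightarrow> V (C + D) (f - g))"

lemma ball_familyD:
  assumes "ball_family V"
  shows "V C f \<Longrightarrow> 0 \<le> C" "V C f \<Longrightarrow> C \<le> D \<Longrightarrow> V D f"
    "V C f \<Longrightarrow> V D g \<Longrightarrow> V (C + D) (f + g)" "V C f \<Longrightarrow> V D g \<Longrightarrow> V (C + D) (f - g)"
  using assms unfolding ball_family_def by blast+

text \<open>Bounded operators that are row finite, hence adjoints of operators between preduals.\<close>

definition bounded_op ::
  "(real \<Rightarrow> ('a \<Rightarrow> real) \<Rightarrow> bool) \<Rightarrow> (real \<Rightarrow> ('b \<Rightarrow> real) \<Rightarrow> bool) \<Rightarrow> (('a \<Rightarrow> real) \<Rightarrow> ('b \<Rightarrow> real)) \<Rightarrow> bool" where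
  "bounded_op V W T \<longleftrightarrow> row_finite T \<and> (\<exists>K\<ge>0. \<forall>C f. V C f \<longrightarrow> W (K * C) (T f))"

lemma bounded_opI:
  assumes "\<And>x. (\<lambda>f. T f x) \<in> finite_functionals" "0 \<le> K" "\<And>C f. V C f \<Longrightarrow> W (K * C) (T f)"
  shows "bounded_op V W T"
  using assms unfolding bounded_op_def row_finite_def by blast

lemma bounded_opE:
  assumes "bounded_op V W T"
  obtains K where "0 \<le> K" "\<And>C f. V C f \<Longrightarrow> W (K * C) (T f)"
  using assms unfolding bounded_op_def by blast

lemma bounded_op_mem:
  assumes "bounded_op V W T" "V C f"
  shows "\<exists>C. W C (T f)"
  using assms unfolding bounded_op_def by blast

lemma bounded_op_row_finite: "bounded_op V W T \<Longrightarrow> row_finite T"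
  by (simp add: bounded_op_def)

lemma bounded_op_id: "bounded_op V V (\<lambda>f. f)"
  by (rule bounded_opI[where K = 1]) (auto intro: finite_functional_eval)

lemma bounded_op_comp:
  assumes "bounded_op V W T" "bounded_op W Z S"
  shows "bounded_op V Z (\<lambda>f. S (T f))"
proof -
  obtain K where K: "0 \<le> K" "\<And>C f. V C f \<Longrightarrow> W (K * C) (T f)" using bounded_opE[OF assms(1)] by blast
  obtain L where L: "0 \<le> L" "\<And>C f. W C f \<Longrightarrow> Z (L * C) (S f)" using bounded_opE[OF assms(2)] by blast
  have "Z (L * K * C) (S (T f))" if "V C f" for C f
    using L(2)[OF K(2)[OF that]] by (simp add: mult.assoc)
  then show ?thesis
    using row_finite_comp[of S T] assms K(1) L(1) unfolding bounded_op_def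
    by (metis mult_nonneg_nonneg)
qed

lemma bounded_op_add:
  assumes "ball_family W" "bounded_op V W T" "bounded_op V W S"
  shows "bounded_op V W (\<lambda>f. T f + S f)"
proof -
  obtain K where K: "0 \<le> K" "\<And>C f. V C f \<Longrightarrow> W (K * C) (T f)" using bounded_opE[OF assms(2)] by blast
  obtain L where L: "0 \<le> L" "\<And>C f. V C f \<Longrightarrow> W (L * C) (S f)" using bounded_opE[OF assms(3)] by blast
  show ?thesis
  proof (rule bounded_opI[where K = "K + L"])
    fix x show "(\<lambda>f. (T f + S f) x) \<in> finite_functionals"
      using assms by (auto simp: bounded_op_def row_finite_def intro!: finite_functional_add)
  next
    fix C f assume "V C f"
    then show "W ((K + L) * C) (T f + S f)"
      unfolding distrib_right by (intro ball_familyD(3)[OF assms(1)] K L)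
  qed (use K L in auto)
qed

lemma bounded_op_diff:
  assumes "ball_family W" "bounded_op V W T" "bounded_op V W S"
  shows "bounded_op V W (\<lambda>f. T f - S f)"
proof -
  obtain K where K: "0 \<le> K" "\<And>C f. V C f \<Longrightarrow> W (K * C) (T f)" using bounded_opE[OF assms(2)] by blast
  obtain L where L: "0 \<le> L" "\<And>C f. V C f \<Longrightarrow> W (L * C) (S f)" using bounded_opE[OF assms(3)] by blast
  show ?thesis
  proof (rule bounded_opI[where K = "K + L"])
    fix x show "(\<lambda>f. (T f - S f) x) \<in> finite_functionals"
      using assms by (auto simp: bounded_op_def row_finite_def intro!: finite_functional_diff)
  next
    fix C f assume "V C f"
    then show "W ((K + L) * C) (T f - S f)"
      unfolding distrib_right by (intro ball_familyD(4)[OF assms(1)] K L)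
  qed (use K L in auto)
qed

text \<open>The spaces are isomorphic through row finite operators. The operators act on all functions, but they need
  to be inverse to each other only on the spaces.\<close>

definition family_iso :: "(real \<Rightarrow> ('a \<Rightarrow> real) \<Rightarrow> bool) \<Rightarrow> (real \<Rightarrow> ('b \<Rightarrow> real) \<Rightarrow> bool) \<Rightarrow> bool" where
  "family_iso V W \<longleftrightarrow>
     (\<exists>T S. bounded_op V W T \<and> bounded_op W V S \<and>
            (\<forall>C f. V C f \<longrightarrow> S (T f) = f) \<and> (\<forall>C g. W C g \<longrightarrow> T (S g) = g))"

text \<open>\<open>V\<close> is isomorphic to a complemented subspace of \<open>W\<close>: the identity of \<open>V\<close> factors through \<open>W\<close>.\<close>

definition complemented :: "(real \<Rightarrow> ('a \<Rightarrow> real) \<Rightarrow> bool) \<Rightarrow> (real \<Rightarrow> ('b \<Rightarrow> real) \<Rightarrow> bool) \<Rightarrow> bool" where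
  "complemented V W \<longleftrightarrow>
     (\<exists>i r. bounded_op V W i \<and> bounded_op W V r \<and> (\<forall>C f. V C f \<longrightarrow> r (i f) = f))"

lemma family_iso_sym: "family_iso V W \<Longrightarrow> family_iso W V"
  unfolding family_iso_def by blast

lemma family_iso_trans:
  assumes "family_iso V W" "family_iso W Z"
  shows "family_iso V Z"
proof -
  obtain T S where 1: "bounded_op V W T" "bounded_op W V S"
    "\<And>C f. V C f \<Longrightarrow> S (T f) = f" "\<And>C g. W C g \<Longrightarrow> T (S g) = g"
    using assms(1) unfolding family_iso_def by blast
  obtain T' S' where 2: "bounded_op W Z T'" "bounded_op Z W S'"
    "\<And>C f. W C f \<Longrightarrow> S' (T' f) = f" "\<And>C g. Z C g \<Longrightarrow> T' (S' g) = g"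
    using assms(2) unfolding family_iso_def by blast
  have "S (S' (T' (T f))) = f" if "V C f" for C f
    using 1(1,3) 2(3) that by (metis bounded_opE)
  moreover have "T' (T (S (S' g))) = g" if "Z C g" for C g
    using 2(2,4) 1(4) that by (metis bounded_opE)
  ultimately show ?thesis
    unfolding family_iso_def using bounded_op_comp[OF 1(1) 2(1)] bounded_op_comp[OF 2(2) 1(2)]
    by blast
qed

lemma complemented_trans:
  assumes "complemented V W" "complemented W Z"
  shows "complemented V Z"
proof -
  obtain i r where 1: "bounded_op V W i" "bounded_op W V r" "\<And>C f. V C f \<Longrightarrow> r (i f) = f"
    using assms(1) unfolding complemented_def by blast
  obtain i' r' where 2: "bounded_op W Z i'" "bounded_op Z W r'" "\<And>C f. W C f \<Longrightarrow> r' (i' f) = f"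
    using assms(2) unfolding complemented_def by blast
  have "r (r' (i' (i f))) = f" if "V C f" for C f
    using 1(1,3) 2(3) that by (metis bounded_opE)
  then show ?thesis
    unfolding complemented_def using bounded_op_comp[OF 1(1) 2(1)] bounded_op_comp[OF 2(2) 1(2)]
    by blast
qed

text \<open>
  Pelczynski's decomposition method. The bijection \<open>\<sigma>\<close> splits a function in \<open>U\<close> into a
  bounded sequence of functions in \<open>U\<close>, so \<open>U\<close> is its own \<open>\<ell>\<^sub>\<infinity>\<close>-power. Writing \<open>X \<oplus> X'\<close> for \<open>U\<close> and \<open>U \<oplus> U'\<close>
  for \<open>X\<close>, one has \<open>U \<cong> X \<oplus> U\<close> and \<open>X \<cong> U \<oplus> X\<close>. To avoid spaces
  for the complements, the composite isomorphism and its inverse are written down explicitly.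
\<close>

theorem pelczynski_decomposition:
  fixes X :: "real \<Rightarrow> ('x \<Rightarrow> real) \<Rightarrow> bool" and U :: "real \<Rightarrow> ('u \<Rightarrow> real) \<Rightarrow> bool"
    and \<sigma> :: "nat \<times> 'u \<Rightarrow> 'u"
  assumes X: "ball_family X" and U: "ball_family U"
    and \<sigma>: "bij \<sigma>" "\<And>C v. U C v \<longleftrightarrow> (\<forall>n. U C (\<lambda>p. v (\<sigma> (n, p))))"
    and XU: "complemented X U" and UX: "complemented U X"
  shows "family_iso X U"
proof -
  obtain i r where i: "bounded_op X U i" and r: "bounded_op U X r"
    and ri: "\<And>C f. X C f \<Longrightarrow> r (i f) = f"
    using XU unfolding complemented_def by blast
  obtain j s where j: "bounded_op U X j" and s: "bounded_op X U s"
    and sj: "\<And>C f. U C f \<Longrightarrow> s (j f) = f"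
    using UX unfolding complemented_def by blast
  define slice where "slice n v = (\<lambda>p. v (\<sigma> (n, p)))" for n and v :: "'u \<Rightarrow> real"
  define glue where "glue w = (\<lambda>q. case inv \<sigma> q of (n, p) \<Rightarrow> w n p)" for w :: "nat \<Rightarrow> 'u \<Rightarrow> real"
  have inv: "inv \<sigma> (\<sigma> q) = q" "\<sigma> (inv \<sigma> p) = p" for p q
    using \<sigma>(1) by (simp_all add: bij_is_inj bij_is_surj surj_f_inv_f)
  have slice_glue [simp]: "slice n (glue w) = w n" for n w
    by (simp add: slice_def glue_def inv)
  have glue_slice [simp]: "glue (\<lambda>n. slice n v) = v" for v
    by (simp add: slice_def glue_def inv case_prod_unfold)
  have U_slice: "U C (slice n v)" if "U C v" for C n v
    using \<sigma>(2) that unfolding slice_def by blast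
  have U_glue: "U C (glue w)" if "\<And>n. U C (w n)" for C w
    using \<sigma>(2)[of C "glue w"] that slice_glue unfolding slice_def by metis
  have slice_op: "bounded_op U U (slice n)" for n
    by (rule bounded_opI[where K = 1])
      (simp_all add: U_slice[unfolded slice_def] slice_def finite_functional_eval)
  note gU = ball_familyD[OF U]
  note lin = row_finite_linear[OF bounded_op_row_finite]
  note lins = lin(1,2)[OF i] lin(1,2)[OF r] lin(1,2)[OF j] lin(1,2)[OF s]

  \<comment> \<open>\<open>P\<close> is the projection of \<open>U\<close> onto the copy of \<open>X\<close>, and \<open>Q\<close> is the complementary projection.\<close>
  define P where "P v = i (r v)" for v
  define Q where "Q v = v - i (r v)" for v
  have P: "bounded_op U U P" unfolding P_def by (rule bounded_op_comp[OF r i])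
  have Q: "bounded_op U U Q" unfolding Q_def
    by (rule bounded_op_diff[OF U bounded_op_id bounded_op_comp[OF r i]])
  have shift_op: "bounded_op V U (\<lambda>v. glue (\<lambda>n. case n of 0 \<Rightarrow> A v | Suc n \<Rightarrow> P (slice (n + a) (B v)) + Q (slice (n + b) (B v))))"
    if A: "bounded_op V U A" and B: "bounded_op V U B" for V :: "real \<Rightarrow> ('v \<Rightarrow> real) \<Rightarrow> bool" and A B a b
  proof -
    obtain KA where KA: "0 \<le> KA" "\<And>C f. V C f \<Longrightarrow> U (KA * C) (A f)" using bounded_opE[OF A] by blast
    obtain KB where KB: "0 \<le> KB" "\<And>C f. V C f \<Longrightarrow> U (KB * C) (B f)" using bounded_opE[OF B] by blast
    obtain KP where KP: "0 \<le> KP" "\<And>C f. U C f \<Longrightarrow> U (KP * C) (P f)" using bounded_opE[OF P] by blast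
    obtain KQ where KQ: "0 \<le> KQ" "\<And>C f. U C f \<Longrightarrow> U (KQ * C) (Q f)" using bounded_opE[OF Q] by blast
    have rf: "row_finite (\<lambda>v. P (slice (n + a) (B v)) + Q (slice (n + b) (B v)))" for n
      by (rule bounded_op_row_finite[OF bounded_op_add[OF U bounded_op_comp[OF bounded_op_comp[OF B slice_op] P]
          bounded_op_comp[OF bounded_op_comp[OF B slice_op] Q]]])
    show ?thesis
    proof (rule bounded_opI[where K = "KA + (KP * KB + KQ * KB)"])
      fix x
      obtain n p where np: "inv \<sigma> x = (n, p)" by fastforce
      show "(\<lambda>f. glue (\<lambda>n. case n of 0 \<Rightarrow> A f | Suc n \<Rightarrow> P (slice (n + a) (B f)) + Q (slice (n + b) (B f))) x) \<in> finite_functionals"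
        using rf[unfolded row_finite_def, rule_format, of "n - 1" p]
          bounded_op_row_finite[OF A, unfolded row_finite_def, rule_format, of p]
        by (cases n) (simp_all only: glue_def np prod.case nat.case diff_Suc_1)
    next
      fix C f assume f: "V C f"
      have C: "0 \<le> KA * C" "0 \<le> KP * (KB * C) + KQ * (KB * C)"
        by (intro gU(1)[OF KA(2)[OF f]] add_nonneg_nonneg gU(1)[OF KP(2)[OF KB(2)[OF f]]]
            gU(1)[OF KQ(2)[OF KB(2)[OF f]]])+
      have "U (KA * C + (KP * (KB * C) + KQ * (KB * C))) (A f)"
        by (rule gU(2)[OF KA(2)[OF f]]) (use C in linarith)
      moreover have "U (KA * C + (KP * (KB * C) + KQ * (KB * C))) (P (slice (n + a) (B f)) + Q (slice (n + b) (B f)))" for n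
      proof (rule gU(2))
        show "U (KP * (KB * C) + KQ * (KB * C)) (P (slice (n + a) (B f)) + Q (slice (n + b) (B f)))"
          by (intro gU(3) KP(2) KQ(2) U_slice KB(2) f)
      qed (use C in linarith)
      ultimately have "U (KA * C + (KP * (KB * C) + KQ * (KB * C)))
          (glue (\<lambda>n. case n of 0 \<Rightarrow> A f | Suc n \<Rightarrow> P (slice (n + a) (B f)) + Q (slice (n + b) (B f))))"
        by (intro U_glue) (simp split: nat.split)
      then show "U ((KA + (KP * KB + KQ * KB)) * C)
          (glue (\<lambda>n. case n of 0 \<Rightarrow> A f | Suc n \<Rightarrow> P (slice (n + a) (B f)) + Q (slice (n + b) (B f))))"
        by (simp only: distrib_right mult.assoc)
    qed (use KA(1) KB(1) KP(1) KQ(1) in simp)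
  qed

  \<comment> \<open>\<open>T\<close> reads \<open>y\<close> as a sequence \<open>w\<^sub>0, w\<^sub>1, \<dots>\<close> in \<open>U\<close> (the slices of \<open>s y\<close>) plus a complement; \<open>w\<^sub>0\<close> and the
    complement form the element \<open>H y\<close> of \<open>X\<close>. Its copy in \<open>U\<close> is inserted as the \<open>P\<close>-part in front of the
    sequence \<open>w\<^sub>1, w\<^sub>2, \<dots>\<close>, whose \<open>P\<close>-parts move one place up. \<open>S\<close> reverses this.\<close>
  define H where "H y = j (slice 0 (s y)) + (y - j (s y))" for y
  define T where "T y = glue (\<lambda>n. case n of 0 \<Rightarrow> i (H y) + Q (slice 1 (s y))
      | Suc n \<Rightarrow> P (slice (n + 1) (s y)) + Q (slice (n + 2) (s y)))" for y
  define c where "c v = glue (\<lambda>n. case n of 0 \<Rightarrow> s (r (slice 0 v))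
      | Suc n \<Rightarrow> P (slice (n + 1) v) + Q (slice (n + 0) v))" for v
  define S where "S v = j (c v) + (r (slice 0 v) - j (s (r (slice 0 v))))" for v
  have H: "bounded_op X X H" unfolding H_def
    by (intro bounded_op_add[OF X] bounded_op_diff[OF X] bounded_op_id bounded_op_comp[OF s j]
        bounded_op_comp[OF bounded_op_comp[OF s slice_op] j])
  have T: "bounded_op X U T" unfolding T_def
    by (intro shift_op bounded_op_add[OF U] bounded_op_comp[OF H i] s bounded_op_comp[OF bounded_op_comp[OF s slice_op] Q])
  have r0: "bounded_op U X (\<lambda>v. r (slice 0 v))" by (rule bounded_op_comp[OF slice_op r])
  have c: "bounded_op U U c" unfolding c_def
    by (intro shift_op bounded_op_comp[OF r0 s] bounded_op_id)
  have S: "bounded_op U X S" unfolding S_def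
    by (intro bounded_op_add[OF X] bounded_op_diff[OF X] r0 bounded_op_comp[OF c j]
        bounded_op_comp[OF bounded_op_comp[OF r0 s] j])

  have PQ: "r (Q v) = 0" "P v + Q v = v" "P (P v) = P v" "P (Q v) = 0" "Q (P v) = 0" "Q (Q v) = Q v"
    if "U C v" for C v
  proof -
    have rir: "r (i (r v)) = r v" using ri bounded_op_mem[OF r] that by blast
    have z: "i 0 = 0" "r 0 = 0" using lin(2)[OF i, of 0 0] lin(2)[OF r, of 0 0] by auto
    show "r (Q v) = 0" "P v + Q v = v" "P (P v) = P v" "P (Q v) = 0" "Q (P v) = 0" "Q (Q v) = Q v"
      unfolding P_def Q_def by (simp_all add: lins rir z)
  qed
  have Plin: "P (v + w) = P v + P w" "Q (v + w) = Q v + Q w" for v w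
    unfolding P_def Q_def by (simp_all add: lins)
  have ST: "S (T y) = y" if y: "X C y" for C y
  proof -
    obtain C1 where sy: "U C1 (s y)" using bounded_op_mem[OF s] y by blast
    have sl: "U C1 (slice n (s y))" for n by (rule U_slice[OF sy])
    obtain C2 where Hy: "X C2 (H y)" using bounded_op_mem[OF H] y by blast
    have sH: "s (H y) = slice 0 (s y)"
      unfolding H_def by (simp add: lins sj[OF sl] sj[OF sy])
    have T0: "slice 0 (T y) = i (H y) + Q (slice 1 (s y))"
      and TS: "slice (Suc n) (T y) = P (slice (n + 1) (s y)) + Q (slice (n + 2) (s y))" for n
      by (simp_all only: T_def slice_glue nat.case)
    have rT: "r (slice 0 (T y)) = H y"
      unfolding T0 by (simp add: lins ri[OF Hy] PQ(1)[OF sl])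
    have PiH: "Q (i (H y)) = 0" unfolding Q_def by (simp add: ri[OF Hy])
    have "c (T y) = glue (\<lambda>n. slice n (s y))"
      unfolding c_def
    proof (rule arg_cong[of _ _ glue], rule ext)
      fix n
      show "(case n of 0 \<Rightarrow> s (r (slice 0 (T y))) | Suc n \<Rightarrow> P (slice (n + 1) (T y)) + Q (slice (n + 0) (T y))) = slice n (s y)"
      proof (cases n)
        case 0 then show ?thesis by (simp add: rT sH)
      next
        case (Suc m)
        then show ?thesis
        proof (cases m)
          case 0
          then show ?thesis using Suc PQ(2)[OF sl, of 1]
            by (simp add: T0 TS Plin PiH PQ(3-)[OF sl])
        next
          case (Suc l)
          then show ?thesis using \<open>n = Suc m\<close> PQ(2)[OF sl, of n]
            by (simp add: TS Plin PQ(3-)[OF sl])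
        qed
      qed
    qed
    then have "c (T y) = s y" by simp
    then show ?thesis unfolding S_def rT sH by (simp add: H_def)
  qed
  have TS: "T (S v) = v" if v: "U C v" for C v
  proof -
    have sl: "U C (slice n v)" for n by (rule U_slice[OF v])
    obtain C1 where x: "X C1 (r (slice 0 v))" using bounded_op_mem[OF r0] v by blast
    obtain C2 where sx: "U C2 (s (r (slice 0 v)))" using bounded_op_mem[OF s] x by blast
    obtain C3 where cv: "U C3 (c v)" using bounded_op_mem[OF c] v by blast
    have sS: "s (S v) = c v" unfolding S_def by (simp add: lins sj[OF cv] sj[OF sx])
    have c0: "slice 0 (c v) = s (r (slice 0 v))"
      and cS: "slice (Suc n) (c v) = P (slice (n + 1) v) + Q (slice n v)" for n
      by (simp_all only: c_def slice_glue nat.case add_0_right)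
    have HS: "H (S v) = r (slice 0 v)" unfolding H_def sS c0 by (simp add: S_def)
    have "T (S v) = glue (\<lambda>n. slice n v)"
      unfolding T_def
    proof (rule arg_cong[of _ _ glue], rule ext)
      fix n
      show "(case n of 0 \<Rightarrow> i (H (S v)) + Q (slice 1 (s (S v)))
          | Suc n \<Rightarrow> P (slice (n + 1) (s (S v))) + Q (slice (n + 2) (s (S v)))) = slice n v"
      proof (cases n)
        case 0
        then show ?thesis using PQ(2)[OF sl, of 0]
          by (simp add: HS sS cS Plin PQ(3-)[OF sl] P_def[symmetric])
      next
        case (Suc m)
        then show ?thesis using PQ(2)[OF sl, of n]
          by (simp add: sS cS Plin PQ(3-)[OF sl])
      qed
    qed
    then show ?thesis by simp
  qed
  show ?thesis unfolding family_iso_def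
    by (intro exI[of _ T] exI[of _ S] conjI allI impI T S) (erule ST TS)+
qed

section \<open>From spaces of Lipschitz functions to free spaces\<close>

text \<open>The ball of radius \<open>C\<close> in \<open>Lip\<^sub>0(M)\<close> with basepoint \<open>z\<close>.\<close>

definition lip_ball :: "'a metric \<Rightarrow> 'a \<Rightarrow> real \<Rightarrow> ('a \<Rightarrow> real) \<Rightarrow> bool" where
  "lip_ball M z C f \<longleftrightarrow> 0 \<le> C \<and> f z = 0 \<and> (\<forall>x. x \<notin> mspace M \<longrightarrow> f x = 0) \<and>
     (\<forall>x\<in>mspace M. \<forall>y\<in>mspace M. \<bar>f x - f y\<bar> \<le> C * mdist M x y)"

lemma lip_ball_mono: "lip_ball M z C f \<Longrightarrow> C \<le> D \<Longrightarrow> lip_ball M z D f"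
  unfolding lip_ball_def by (meson mdist_nonneg mult_right_mono order_trans)

lemma ball_family_lip_ball: "ball_family (lip_ball M z)"
  unfolding ball_family_def
proof (intro conjI allI impI)
  fix C D f g assume *: "lip_ball M z C f" "lip_ball M z D g"
  have "\<bar>(f x + g x) - (f y + g y)\<bar> \<le> (C + D) * mdist M x y \<and>
        \<bar>(f x - g x) - (f y - g y)\<bar> \<le> (C + D) * mdist M x y"
    if "x \<in> mspace M" "y \<in> mspace M" for x y
  proof -
    have "\<bar>f x - f y\<bar> \<le> C * mdist M x y" "\<bar>g x - g y\<bar> \<le> D * mdist M x y"
      using * that unfolding lip_ball_def by blast+
    then show ?thesis unfolding distrib_right by linarith
  qed
  then show "lip_ball M z (C + D) (f + g)" "lip_ball M z (C + D) (f - g)"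
    using * unfolding lip_ball_def by auto
qed (auto simp: lip_ball_mono, auto simp: lip_ball_def)

lemma vectors_Lip0: "vectors (Lip0 M z) = {f. \<exists>C. lip_ball M z C f}"
proof -
  have "Lipschitz_continuous_map M euclidean_metric f \<longleftrightarrow>
    (\<exists>C\<ge>0. \<forall>x\<in>mspace M. \<forall>y\<in>mspace M. \<bar>f x - f y\<bar> \<le> C * mdist M x y)" (is "?L \<longleftrightarrow> ?R")
    for f :: "'a \<Rightarrow> real"
  proof
    show "?L \<Longrightarrow> ?R" unfolding Lipschitz_continuous_map_pos dist_real_def mdist_euclidean_metric
      using less_imp_le by blast
    show "?R \<Longrightarrow> ?L" unfolding Lipschitz_continuous_map_def by (auto simp: dist_real_def)
  qed
  then show ?thesis unfolding Lip0_def lip_ball_def by auto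
qed

lemma nrm_Lip0_le:
  assumes "lip_ball M z C f"
  shows "nrm (Lip0 M z) f \<le> C"
  using assms unfolding Lip0_def lipschitz_const_def lip_ball_def
  by (auto intro!: cInf_lower bdd_belowI[where m = 0])

lemma lip_ball_nrm:
  assumes "f \<in> vectors (Lip0 M z)"
  shows "lip_ball M z (nrm (Lip0 M z) f) f"
proof -
  let ?S = "{L. 0 \<le> L \<and> (\<forall>x\<in>mspace M. \<forall>y\<in>mspace M. \<bar>f x - f y\<bar> \<le> L * mdist M x y)}"
  obtain C where C: "lip_ball M z C f" using assms by (auto simp: vectors_Lip0)
  then have ne: "?S \<noteq> {}" by (auto simp: lip_ball_def)
  have eq: "nrm (Lip0 M z) f = Inf ?S" by (simp add: Lip0_def lipschitz_const_def)
  have 0: "0 \<le> Inf ?S" by (rule cInf_greatest[OF ne]) simp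
  have "\<bar>f x - f y\<bar> \<le> Inf ?S * mdist M x y" if xy: "x \<in> mspace M" "y \<in> mspace M" for x y
  proof (cases "mdist M x y = 0")
    case True
    have "\<bar>f x - f y\<bar> \<le> C * mdist M x y" using C xy unfolding lip_ball_def by blast
    then show ?thesis using True by simp
  next
    case False
    then have pos: "mdist M x y > 0" by (simp add: less_le)
    have "\<bar>f x - f y\<bar> / mdist M x y \<le> Inf ?S"
      by (rule cInf_greatest[OF ne]) (use xy pos in \<open>auto simp: divide_le_eq\<close>)
    then show ?thesis using pos by (simp add: divide_le_eq)
  qed
  then show ?thesis using C 0 unfolding lip_ball_def eq by auto
qed

lemma lip_ball_scale: "lip_ball M z C f \<Longrightarrow> lip_ball M z (\<bar>c\<bar> * C) (c *\<^sub>R f)"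
  unfolding lip_ball_def scaleR_fun_def
  by (auto simp: abs_mult mult.assoc mult_left_mono simp flip: right_diff_distrib)

lemma Lip0_add: "f \<in> vectors (Lip0 M z) \<Longrightarrow> g \<in> vectors (Lip0 M z) \<Longrightarrow> f + g \<in> vectors (Lip0 M z)"
  using ball_familyD(3)[OF ball_family_lip_ball] by (fastforce simp: vectors_Lip0)

lemma Lip0_scale: "f \<in> vectors (Lip0 M z) \<Longrightarrow> c *\<^sub>R f \<in> vectors (Lip0 M z)"
  using lip_ball_scale by (fastforce simp: vectors_Lip0)

lemma dual_spaceI:
  assumes "\<And>u v. u \<in> vectors V \<Longrightarrow> v \<in> vectors V \<Longrightarrow> \<phi> (u + v) = \<phi> u + \<phi> v"
    "\<And>c v. v \<in> vectors V \<Longrightarrow> \<phi> (c *\<^sub>R v) = c * \<phi> v"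
    "\<And>v. v \<in> vectors V \<Longrightarrow> \<bar>\<phi> v\<bar> \<le> B * nrm V v"
    "\<And>v. v \<notin> vectors V \<Longrightarrow> \<phi> v = 0"
  shows "\<phi> \<in> vectors (dual_space V)"
  using assms by (auto simp: dual_space_def bounded_linear_map_def real_line_def intro!: exI[of _ B])

lemma dual_spaceD:
  assumes "\<phi> \<in> vectors (dual_space V)"
  shows "u \<in> vectors V \<Longrightarrow> v \<in> vectors V \<Longrightarrow> \<phi> (u + v) = \<phi> u + \<phi> v"
    "v \<in> vectors V \<Longrightarrow> \<phi> (c *\<^sub>R v) = c * \<phi> v"
    "\<exists>B. \<forall>v\<in>vectors V. \<bar>\<phi> v\<bar> \<le> B * nrm V v"
    "v \<notin> vectors V \<Longrightarrow> \<phi> v = 0"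
  using assms by (auto simp: dual_space_def bounded_linear_map_def real_line_def)

lemma dual_bound:
  assumes \<phi>: "\<phi> \<in> vectors (dual_space (Lip0 M z))" and f: "lip_ball M z C f"
  shows "\<bar>\<phi> f\<bar> \<le> nrm (dual_space (Lip0 M z)) \<phi> * C"
proof -
  let ?V = "Lip0 M z"
  let ?S = "{\<bar>\<phi> v\<bar> | v. v \<in> vectors ?V \<and> nrm ?V v \<le> 1}"
  obtain B where B: "\<And>v. v \<in> vectors ?V \<Longrightarrow> \<bar>\<phi> v\<bar> \<le> B * nrm ?V v"
    using dual_spaceD(3)[OF \<phi>] by blast
  note sc = dual_spaceD(2)[OF \<phi>]
  have bdd: "bdd_above ?S"
  proof (rule bdd_aboveI)
    fix t assume "t \<in> ?S"
    then obtain v where v: "t = \<bar>\<phi> v\<bar>" "v \<in> vectors ?V" "nrm ?V v \<le> 1" by auto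
    have "0 \<le> nrm ?V v" using lip_ball_nrm[OF v(2)] by (simp add: lip_ball_def)
    have "t \<le> B * nrm ?V v" using B[OF v(2)] v by simp
    also have "\<dots> \<le> \<bar>B\<bar> * 1" by (intro mult_mono) (use v \<open>0 \<le> nrm ?V v\<close> in auto)
    finally show "t \<le> \<bar>B\<bar>" by simp
  qed
  have fV: "f \<in> vectors ?V" using f by (auto simp: vectors_Lip0)
  have C: "0 \<le> C" using f by (simp add: lip_ball_def)
  show ?thesis
  proof (cases "C = 0")
    case True
    then have "nrm ?V f = 0"
      using nrm_Lip0_le[OF f] lip_ball_nrm[OF fV] by (simp add: lip_ball_def)
    then show ?thesis using B[OF fV] True by simp
  next
    case False
    then have pos: "C > 0" using C by simp
    have "lip_ball M z 1 ((1 / C) *\<^sub>R f)" using lip_ball_scale[OF f, of "1 / C"] pos by simp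
    then have "nrm ?V ((1 / C) *\<^sub>R f) \<le> 1" by (rule nrm_Lip0_le)
    then have "\<bar>\<phi> ((1 / C) *\<^sub>R f)\<bar> \<le> Sup ?S"
      by (intro cSup_upper bdd) (use Lip0_scale[OF fV] in auto)
    then have "\<bar>\<phi> f\<bar> / C \<le> Sup ?S" using sc[OF fV, of "1 / C"] pos by (simp add: abs_mult)
    then show ?thesis using pos by (simp add: dual_space_def divide_le_eq)
  qed
qed

lemma nrm_dual_le:
  assumes "\<And>f. lip_ball M z 1 f \<Longrightarrow> \<bar>\<phi> f\<bar> \<le> B"
  shows "nrm (dual_space (Lip0 M z)) \<phi> \<le> B"
proof -
  have "lip_ball M z 0 0" by (auto simp: lip_ball_def)
  then have z: "0 \<in> vectors (Lip0 M z)" "nrm (Lip0 M z) 0 \<le> 1"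
    using nrm_Lip0_le[of M z 0 0] by (auto simp: vectors_Lip0)
  have "\<bar>\<phi> f\<bar> \<le> B" if "f \<in> vectors (Lip0 M z)" "nrm (Lip0 M z) f \<le> 1" for f
    using assms lip_ball_mono[OF lip_ball_nrm[OF that(1)] that(2)] by blast
  then show ?thesis
    unfolding dual_space_def using z by (auto intro!: cSup_least)
qed

text \<open>The adjoint of an operator \<open>T\<close> on \<open>Lip\<^sub>0(M)\<close>; like all functionals it is extended by \<open>0\<close>.\<close>

definition adjoint_map where
  "adjoint_map M z T \<psi> = (\<lambda>f. if f \<in> vectors (Lip0 M z) then \<psi> (T f) else 0)"

lemma adjoint_map_linear: "adjoint_map M z T (\<phi> + \<psi>) = adjoint_map M z T \<phi> + adjoint_map M z T \<psi>"
  "adjoint_map M z T (c *\<^sub>R \<phi>) = c *\<^sub>R adjoint_map M z T \<phi>"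
  "adjoint_map M z T (\<phi> - \<psi>) = adjoint_map M z T \<phi> - adjoint_map M z T \<psi>"
  "adjoint_map M z T 0 = 0"
  by (auto simp: adjoint_map_def scaleR_fun_def fun_eq_iff)

lemma finite_functional_restrict:
  fixes M :: "'a metric"
  assumes "\<phi> \<in> finite_functionals"
  shows "(\<lambda>f. if f \<in> vectors (Lip0 M z) then \<phi> f else 0) \<in> span (evaluation M z ` mspace M)"
  using assms unfolding finite_functionals_def
proof (induction rule: span_induct_alt)
  case base
  have "(\<lambda>f. if f \<in> vectors (Lip0 M z) then 0 f else 0) = (0 :: ('a \<Rightarrow> real) \<Rightarrow> real)" by auto
  then show ?case by (simp add: span_zero del: zero_fun_apply)
next
  case (step c \<psi> \<phi>)
  then obtain x where x: "\<psi> = (\<lambda>f. f x)" by auto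
  have "evaluation M z x \<in> span (evaluation M z ` mspace M)"
  proof (cases "x \<in> mspace M")
    case True then show ?thesis by (intro span_base) auto
  next
    case False
    then have "evaluation M z x = 0"
      by (auto simp: evaluation_def fun_eq_iff vectors_Lip0 lip_ball_def)
    then show ?thesis by (simp add: span_zero)
  qed
  then have "c *\<^sub>R evaluation M z x + (\<lambda>f. if f \<in> vectors (Lip0 M z) then \<phi> f else 0)
      \<in> span (evaluation M z ` mspace M)"
    by (intro span_add span_scale step(2))
  moreover have "c *\<^sub>R evaluation M z x + (\<lambda>f. if f \<in> vectors (Lip0 M z) then \<phi> f else 0)
      = (\<lambda>f. if f \<in> vectors (Lip0 M z) then (c *\<^sub>R \<psi> + \<phi>) f else 0)"
    by (auto simp: fun_eq_iff x scaleR_fun_def evaluation_def)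
  ultimately show ?case by simp
qed

context
  fixes M :: "'a metric" and z :: 'a and N :: "'b metric" and w :: 'b
    and T :: "('a \<Rightarrow> real) \<Rightarrow> ('b \<Rightarrow> real)"
  assumes T: "bounded_op (lip_ball M z) (lip_ball N w) T"
begin

lemma op_Lip0: "f \<in> vectors (Lip0 M z) \<Longrightarrow> T f \<in> vectors (Lip0 N w)"
  using T by (auto simp: vectors_Lip0 elim!: bounded_opE)

lemma adjoint_map_dual:
  assumes \<psi>: "\<psi> \<in> vectors (dual_space (Lip0 N w))"
  shows "adjoint_map M z T \<psi> \<in> vectors (dual_space (Lip0 M z))"
proof -
  obtain K where K: "0 \<le> K" "\<And>C f. lip_ball M z C f \<Longrightarrow> lip_ball N w (K * C) (T f)"
    using bounded_opE[OF T] by blast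
  have "\<bar>\<psi> (T f)\<bar> \<le> nrm (dual_space (Lip0 N w)) \<psi> * K * nrm (Lip0 M z) f" if "f \<in> vectors (Lip0 M z)" for f
    using dual_bound[OF \<psi> K(2)[OF lip_ball_nrm[OF that]]] by (simp add: mult.assoc)
  then show ?thesis
    by (intro dual_spaceI) (auto simp: adjoint_map_def Lip0_add Lip0_scale op_Lip0 dual_spaceD(1,2)[OF \<psi>]
        row_finite_linear[OF bounded_op_row_finite[OF T]])
qed

lemma adjoint_map_bounded:
  "\<exists>K\<ge>0. \<forall>\<psi>\<in>vectors (dual_space (Lip0 N w)).
    nrm (dual_space (Lip0 M z)) (adjoint_map M z T \<psi>) \<le> K * nrm (dual_space (Lip0 N w)) \<psi>"
proof -
  obtain K where K: "0 \<le> K" "\<And>C f. lip_ball M z C f \<Longrightarrow> lip_ball N w (K * C) (T f)"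
    using bounded_opE[OF T] by blast
  have "nrm (dual_space (Lip0 M z)) (adjoint_map M z T \<psi>) \<le> K * nrm (dual_space (Lip0 N w)) \<psi>"
    if "\<psi> \<in> vectors (dual_space (Lip0 N w))" for \<psi>
  proof (rule nrm_dual_le)
    fix f assume f: "lip_ball M z 1 f"
    then have "adjoint_map M z T \<psi> f = \<psi> (T f)" by (auto simp: adjoint_map_def vectors_Lip0)
    then show "\<bar>adjoint_map M z T \<psi> f\<bar> \<le> K * nrm (dual_space (Lip0 N w)) \<psi>"
      using dual_bound[OF that K(2)[OF f]] by (simp add: mult.commute)
  qed
  then show ?thesis using K(1) by blast
qed

text \<open>By row finiteness the adjoint maps point evaluations to finite combinations of point evaluations.\<close>

lemma adjoint_map_span:
  assumes "\<psi> \<in> span (evaluation N w ` mspace N)"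
  shows "adjoint_map M z T \<psi> \<in> span (evaluation M z ` mspace M)"
  using assms
proof (induction rule: span_induct_alt)
  case base
  show ?case unfolding adjoint_map_linear by (rule span_zero)
next
  case (step c \<psi> \<phi>)
  then obtain y where y: "\<psi> = evaluation N w y" by auto
  have "adjoint_map M z T \<psi> = (\<lambda>f. if f \<in> vectors (Lip0 M z) then T f y else 0)"
    by (auto simp: y adjoint_map_def evaluation_def fun_eq_iff op_Lip0)
  moreover have "(\<lambda>f. T f y) \<in> finite_functionals"
    using bounded_op_row_finite[OF T] by (simp add: row_finite_def)
  ultimately have "adjoint_map M z T \<psi> \<in> span (evaluation M z ` mspace M)"
    using finite_functional_restrict by simp
  then show ?case using step unfolding adjoint_map_linear by (intro span_add span_scale)
qed

end

lemma evaluation_dual: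
  assumes "x \<in> mspace M" "z \<in> mspace M"
  shows "evaluation M z x \<in> vectors (dual_space (Lip0 M z))"
proof -
  have "\<bar>f x\<bar> \<le> mdist M x z * nrm (Lip0 M z) f" if "f \<in> vectors (Lip0 M z)" for f
    using lip_ball_nrm[OF that] assms unfolding lip_ball_def
    by (metis diff_zero mult.commute)
  then show ?thesis
    by (intro dual_spaceI) (auto simp: evaluation_def Lip0_add Lip0_scale, simp add: scaleR_fun_def)
qed

lemma dual_subspace: "subspace (vectors (dual_space V))"
proof (rule subspaceI)
  show "0 \<in> vectors (dual_space V)"
    by (rule dual_spaceI[where B = 0]) auto
next
  fix \<phi> \<psi> assume *: "\<phi> \<in> vectors (dual_space V)" "\<psi> \<in> vectors (dual_space V)"
  obtain A B where AB: "\<And>v. v \<in> vectors V \<Longrightarrow> \<bar>\<phi> v\<bar> \<le> A * nrm V v"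
    "\<And>v. v \<in> vectors V \<Longrightarrow> \<bar>\<psi> v\<bar> \<le> B * nrm V v"
    using *[THEN dual_spaceD(3)] by blast
  have "\<bar>\<phi> v + \<psi> v\<bar> \<le> (A + B) * nrm V v" if "v \<in> vectors V" for v
    using AB[OF that] unfolding distrib_right by linarith
  then show "\<phi> + \<psi> \<in> vectors (dual_space V)"
    by (intro dual_spaceI[where B = "A + B"]) (use *[THEN dual_spaceD(1)] *[THEN dual_spaceD(2)] *[THEN dual_spaceD(4)]
      in \<open>auto simp: distrib_left\<close>)
next
  fix c \<phi> assume *: "\<phi> \<in> vectors (dual_space V)"
  obtain A where "\<And>v. v \<in> vectors V \<Longrightarrow> \<bar>\<phi> v\<bar> \<le> A * nrm V v"
    using *[THEN dual_spaceD(3)] by blast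
  then have "\<bar>c * \<phi> v\<bar> \<le> (\<bar>c\<bar> * A) * nrm V v" if "v \<in> vectors V" for v
    using that by (simp add: abs_mult mult.assoc mult_left_mono)
  then show "c *\<^sub>R \<phi> \<in> vectors (dual_space V)"
    unfolding scaleR_fun_def
    by (intro dual_spaceI[where B = "\<bar>c\<bar> * A"]) (use *[THEN dual_spaceD(1)] *[THEN dual_spaceD(2)] *[THEN dual_spaceD(4)]
      in \<open>auto simp: distrib_left\<close>)
qed

text \<open>Needed because the inverse of an isomorphism is given as \<open>inv_into\<close>: its additivity can only
  be read off from the explicit inverse when the free space is known to be closed under addition.\<close>

lemma free_space_subspace:
  assumes z: "z \<in> mspace M"
  shows "subspace (vectors (lipschitz_free_space M z))"
proof -
  let ?D = "dual_space (Lip0 M z)" and ?S = "span (evaluation M z ` mspace M)"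
  have span_dual: "\<psi> \<in> vectors ?D" if "\<psi> \<in> ?S" for \<psi>
    using span_minimal[OF _ dual_subspace] evaluation_dual[OF _ z] that by blast
  have dual: "subspace (vectors ?D)" by (rule dual_subspace)
  have tri: "nrm ?D (\<phi> + \<psi>) \<le> nrm ?D \<phi> + nrm ?D \<psi>" if "\<phi> \<in> vectors ?D" "\<psi> \<in> vectors ?D" for \<phi> \<psi>
  proof (rule nrm_dual_le)
    fix f assume "lip_ball M z 1 f"
    then have "\<bar>\<phi> f\<bar> \<le> nrm ?D \<phi> * 1" "\<bar>\<psi> f\<bar> \<le> nrm ?D \<psi> * 1"
      using dual_bound[OF that(1), of 1 f] dual_bound[OF that(2), of 1 f] by auto
    then show "\<bar>(\<phi> + \<psi>) f\<bar> \<le> nrm ?D \<phi> + nrm ?D \<psi>" by simp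
  qed
  have hom: "nrm ?D (c *\<^sub>R \<phi>) \<le> \<bar>c\<bar> * nrm ?D \<phi>" if "\<phi> \<in> vectors ?D" for c \<phi>
  proof (rule nrm_dual_le)
    fix f assume "lip_ball M z 1 f"
    then show "\<bar>(c *\<^sub>R \<phi>) f\<bar> \<le> \<bar>c\<bar> * nrm ?D \<phi>"
      using dual_bound[OF that, of 1 f] by (simp add: scaleR_fun_def abs_mult mult_left_mono)
  qed
  show ?thesis
    unfolding lipschitz_free_space_def closed_span_def
  proof (rule subspaceI, simp_all, safe)
    show "0 \<in> vectors ?D" by (rule subspace_0[OF dual])
  next
    fix e :: real assume "e > 0"
    moreover have "nrm ?D 0 \<le> 0" by (rule nrm_dual_le) simp
    ultimately show "\<exists>s\<in>?S. nrm ?D (- s) < e" by (intro bexI[of _ 0]) (auto simp: span_zero)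
  next
    fix \<phi> \<psi> assume "\<phi> \<in> vectors ?D" "\<psi> \<in> vectors ?D"
    then show "\<phi> + \<psi> \<in> vectors ?D" by (rule subspace_add[OF dual])
  next
    fix \<phi> \<psi> and e :: real assume *: "\<phi> \<in> vectors ?D" "\<psi> \<in> vectors ?D" "e > 0"
      "\<forall>e>0. \<exists>s\<in>?S. nrm ?D (\<phi> - s) < e" "\<forall>e>0. \<exists>s\<in>?S. nrm ?D (\<psi> - s) < e"
    then obtain s t where st: "s \<in> ?S" "nrm ?D (\<phi> - s) < e / 2" "t \<in> ?S" "nrm ?D (\<psi> - t) < e / 2"
      by (meson half_gt_zero)
    have "nrm ?D ((\<phi> - s) + (\<psi> - t)) < e"
      using tri[OF subspace_diff[OF dual *(1) span_dual[OF st(1)]] subspace_diff[OF dual *(2) span_dual[OF st(3)]]] st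
      by linarith
    then show "\<exists>s\<in>?S. nrm ?D (\<phi> + \<psi> - s) < e"
      using st by (intro bexI[of _ "s + t"]) (simp_all add: span_add algebra_simps)
  next
    fix c and \<phi> assume "\<phi> \<in> vectors ?D"
    then show "c *\<^sub>R \<phi> \<in> vectors ?D" by (rule subspace_scale[OF dual])
  next
    fix c e :: real and \<phi> assume *: "\<phi> \<in> vectors ?D" "e > 0" "\<forall>e>0. \<exists>s\<in>?S. nrm ?D (\<phi> - s) < e"
    then obtain s where s: "s \<in> ?S" "nrm ?D (\<phi> - s) < e / (\<bar>c\<bar> + 1)"
      by (metis abs_ge_zero add_nonneg_pos divide_pos_pos zero_less_one)
    have "nrm ?D (c *\<^sub>R (\<phi> - s)) \<le> \<bar>c\<bar> * (e / (\<bar>c\<bar> + 1))"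
      using hom[OF subspace_diff[OF dual *(1) span_dual[OF s(1)]], of c] mult_left_mono[OF less_imp_le[OF s(2)], of "\<bar>c\<bar>"]
      by linarith
    also have "\<dots> < e" using *(2) by (simp add: field_simps)
    finally show "\<exists>s\<in>?S. nrm ?D (c *\<^sub>R \<phi> - s) < e"
      using s by (intro bexI[of _ "c *\<^sub>R s"]) (simp_all add: span_scale scaleR_right_diff_distrib)
  qed
qed

lemma adjoint_map_free_space:
  assumes T: "bounded_op (lip_ball M z) (lip_ball N w) T" and w: "w \<in> mspace N"
  shows "bounded_linear_map (lipschitz_free_space N w) (lipschitz_free_space M z) (adjoint_map M z T)"
proof -
  obtain K where K: "0 \<le> K" "\<And>\<psi>. \<psi> \<in> vectors (dual_space (Lip0 N w)) \<Longrightarrow>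
    nrm (dual_space (Lip0 M z)) (adjoint_map M z T \<psi>) \<le> K * nrm (dual_space (Lip0 N w)) \<psi>"
    using adjoint_map_bounded[OF T] by blast
  have span_dual: "\<psi> \<in> vectors (dual_space (Lip0 N w))" if "\<psi> \<in> span (evaluation N w ` mspace N)" for \<psi>
    using span_minimal[OF _ dual_subspace, of "evaluation N w ` mspace N"] evaluation_dual[OF _ w] that by blast
  have approx: "\<exists>s\<in>span (evaluation M z ` mspace M). nrm (dual_space (Lip0 M z)) (adjoint_map M z T \<psi> - s) < e"
    if \<psi>: "\<psi> \<in> vectors (dual_space (Lip0 N w))"
      "\<forall>e>0. \<exists>s\<in>span (evaluation N w ` mspace N). nrm (dual_space (Lip0 N w)) (\<psi> - s) < e"
      and e: "e > 0" for \<psi> e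
  proof -
    have e': "e / (K + 1) > 0" using e K by simp
    obtain s where s: "s \<in> span (evaluation N w ` mspace N)" "nrm (dual_space (Lip0 N w)) (\<psi> - s) < e / (K + 1)"
      using \<psi>(2) e' by blast
    have d: "\<psi> - s \<in> vectors (dual_space (Lip0 N w))"
      using subspace_diff[OF dual_subspace \<psi>(1) span_dual[OF s(1)]] .
    have "nrm (dual_space (Lip0 M z)) (adjoint_map M z T (\<psi> - s)) \<le> K * (e / (K + 1))"
      using K(2)[OF d] mult_left_mono[OF less_imp_le[OF s(2)] K(1)] by linarith
    also have "\<dots> < e" using e K(1) by (simp add: field_simps)
    finally show ?thesis using adjoint_map_span[OF T s(1)] by (auto simp: adjoint_map_linear)
  qed
  then show ?thesis
    unfolding bounded_linear_map_def lipschitz_free_space_def closed_span_def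
    by (auto simp: adjoint_map_linear intro!: adjoint_map_dual[OF T] exI[of _ K] K(2) approx)
qed

theorem free_space_iso:
  assumes iso: "family_iso (lip_ball M z) (lip_ball N w)" and z: "z \<in> mspace M" and w: "w \<in> mspace N"
  shows "lipschitz_free_space M z \<sim>\<^sub>B lipschitz_free_space N w"
proof -
  obtain T S where T: "bounded_op (lip_ball M z) (lip_ball N w) T"
    and S: "bounded_op (lip_ball N w) (lip_ball M z) S"
    and ST: "\<And>C f. lip_ball M z C f \<Longrightarrow> S (T f) = f" and TS: "\<And>C g. lip_ball N w C g \<Longrightarrow> T (S g) = g"
    using iso unfolding family_iso_def by blast
  let ?FM = "lipschitz_free_space M z" and ?FN = "lipschitz_free_space N w"
  let ?A = "adjoint_map N w S" and ?B = "adjoint_map M z T"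
  have A: "bounded_linear_map ?FM ?FN ?A" by (rule adjoint_map_free_space[OF S z])
  have B: "bounded_linear_map ?FN ?FM ?B" by (rule adjoint_map_free_space[OF T w])
  have free_dual: "\<phi> \<in> vectors (dual_space (Lip0 M' z'))" if "\<phi> \<in> vectors (lipschitz_free_space M' z')"
    for \<phi> and M' :: "'c metric" and z'
    using that by (simp add: lipschitz_free_space_def closed_span_def)
  have TS': "T (S g) = g" if "g \<in> vectors (Lip0 N w)" for g
    using that TS by (auto simp: vectors_Lip0)
  have ST': "S (T f) = f" if "f \<in> vectors (Lip0 M z)" for f
    using that ST by (auto simp: vectors_Lip0)
  have AB: "?A (?B \<psi>) = \<psi>" if "\<psi> \<in> vectors ?FN" for \<psi>
    using dual_spaceD(4)[OF free_dual[OF that]] TS' op_Lip0[OF S]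
    by (auto simp: adjoint_map_def)
  have BA: "?B (?A \<phi>) = \<phi>" if "\<phi> \<in> vectors ?FM" for \<phi>
    using dual_spaceD(4)[OF free_dual[OF that]] ST' op_Lip0[OF T]
    by (auto simp: adjoint_map_def)
  have memA: "?A \<phi> \<in> vectors ?FN" if "\<phi> \<in> vectors ?FM" for \<phi>
    using A that by (auto simp: bounded_linear_map_def)
  have memB: "?B \<phi> \<in> vectors ?FM" if "\<phi> \<in> vectors ?FN" for \<phi>
    using B that by (auto simp: bounded_linear_map_def)
  have bij: "bij_betw ?A (vectors ?FM) (vectors ?FN)"
    by (rule bij_betw_byWitness[where f' = ?B]) (auto simp: AB BA memA memB)
  have inv: "inv_into (vectors ?FM) ?A \<psi> = ?B \<psi>" if "\<psi> \<in> vectors ?FN" for \<psi>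
    using that by (metis AB memB bij bij_betw_imp_inj_on inv_into_f_f)
  have "bounded_linear_map ?FN ?FM (inv_into (vectors ?FM) ?A)"
    using B inv subspace_add[OF free_space_subspace[OF w]] subspace_scale[OF free_space_subspace[OF w]]
    unfolding bounded_linear_map_def by auto
  then show ?thesis
    unfolding isomorphic_spaces_def using A bij by blast
qed

section \<open>Lipschitz functions on weighted grids\<close>

text \<open>
  Functions on \<open>\<int> \<times> \<int>\<close> that vanish at the origin and whose increments along the edges over \<open>[i, i + 1]\<close>, in
  either coordinate, are at most \<open>C * w i\<close>. A weight that vanishes outside an interval forces the functions to be
  constant there, so functions on finite squares and on the quadrant are covered
  without restricting the domain.
\<close>

definition grid :: "(int \<Rightarrow> real) \<Rightarrow> real \<Rightarrow> (int \<times> int \<Rightarrow> real) \<Rightarrow> bool" where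
  "grid w C f \<longleftrightarrow> 0 \<le> C \<and> f (0, 0) = 0 \<and>
     (\<forall>i j. \<bar>f (i + 1, j) - f (i, j)\<bar> \<le> C * w i \<and> \<bar>f (i, j + 1) - f (i, j)\<bar> \<le> C * w j)"

lemma gridD:
  assumes "grid w C f"
  shows "0 \<le> C" "f (0, 0) = 0" "\<bar>f (i + 1, j) - f (i, j)\<bar> \<le> C * w i"
    "\<bar>f (i, j + 1) - f (i, j)\<bar> \<le> C * w j"
  using assms unfolding grid_def by blast+

lemma gridI:
  assumes "0 \<le> C" "f (0, 0) = 0" "\<And>i j. \<bar>f (i + 1, j) - f (i, j)\<bar> \<le> C * w i"
    "\<And>i j. \<bar>f (i, j + 1) - f (i, j)\<bar> \<le> C * w j"
  shows "grid w C f"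
  using assms unfolding grid_def by blast

lemma grid_swap: "grid w C f \<Longrightarrow> grid w C (\<lambda>(i, j). f (j, i))"
  unfolding grid_def by auto

lemma ball_family_grid:
  assumes "\<And>i. 0 \<le> w i"
  shows "ball_family (grid w)"
  unfolding ball_family_def
proof (intro conjI allI impI)
  fix C D f assume "grid w C f" "C \<le> D"
  moreover from this have "C * w i \<le> D * w i" for i using assms by (intro mult_right_mono) auto
  ultimately show "grid w D f" unfolding grid_def by (meson order_trans)
next
  fix C D f g assume fg: "grid w C f" "grid w D g"
  show "grid w (C + D) (f + g)" "grid w (C + D) (f - g)"
  proof (rule_tac [!] gridI)
    fix i j
    show "\<bar>(f + g) (i + 1, j) - (f + g) (i, j)\<bar> \<le> (C + D) * w i"
      "\<bar>(f - g) (i + 1, j) - (f - g) (i, j)\<bar> \<le> (C + D) * w i"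
      using gridD(3)[OF fg(1), of i j] gridD(3)[OF fg(2), of i j] unfolding distrib_right by simp_all
    show "\<bar>(f + g) (i, j + 1) - (f + g) (i, j)\<bar> \<le> (C + D) * w j"
      "\<bar>(f - g) (i, j + 1) - (f - g) (i, j)\<bar> \<le> (C + D) * w j"
      using gridD(4)[OF fg(1), of i j] gridD(4)[OF fg(2), of i j] unfolding distrib_right by simp_all
  qed (use gridD(1,2)[OF fg(1)] gridD(1,2)[OF fg(2)] in auto)
qed (auto dest: gridD(1))

lemma grid_path:
  assumes f: "grid w C f" and "i \<le> i'"
  shows "\<bar>f (i', j) - f (i, j)\<bar> \<le> C * sum w {i..<i'}" "\<bar>f (j, i') - f (j, i)\<bar> \<le> C * sum w {i..<i'}"
proof -
  have path: "\<bar>g (i', j) - g (i, j)\<bar> \<le> C * sum w {i..<i'}" if g: "grid w C g" for g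
    using \<open>i \<le> i'\<close>
  proof (induction i' rule: int_ge_induct)
    case base
    then show ?case by simp
  next
    case (step k)
    have "{i..<k + 1} = insert k {i..<k}" using step by auto
    then have "C * sum w {i..<k + 1} = C * w k + C * sum w {i..<k}" by (simp add: distrib_left)
    then show ?case using step.IH gridD(3)[OF g, of k j] by linarith
  qed
  show "\<bar>f (i', j) - f (i, j)\<bar> \<le> C * sum w {i..<i'}" by (rule path[OF f])
  show "\<bar>f (j, i') - f (j, i)\<bar> \<le> C * sum w {i..<i'}" using path[OF grid_swap[OF f]] by simp
qed

lemma grid_path_const:
  assumes f: "grid w C f" and "i \<le> i'" "\<And>k. i \<le> k \<Longrightarrow> k < i' \<Longrightarrow> w k = 0"
  shows "f (i', j) = f (i, j)" "f (j, i') = f (j, i)"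
proof -
  have "sum w {i..<i'} = 0" using assms(3) by simp
  then show "f (i', j) = f (i, j)" "f (j, i') = f (j, i)"
    using grid_path[OF assms(1,2), of j] by auto
qed

text \<open>The weight of the square \<open>[-n, n] \<times> [-n, n]\<close>.\<close>

definition block :: "nat \<Rightarrow> int \<Rightarrow> real" where
  "block n i = (if - int n \<le> i \<and> i < int n then 1 else 0)"

text \<open>The nearest point of \<open>[-n, n]\<close>.\<close>

definition clamp_int :: "nat \<Rightarrow> int \<Rightarrow> int" where
  "clamp_int n i = max (- int n) (min (int n) i)"

lemma grid_block_clamp:
  assumes "grid (block n) C f"
  shows "f (clamp_int n i, clamp_int n j) = f (i, j)"
proof -
  have 1: "f (clamp_int n i, j) = f (i, j) \<and> f (j, clamp_int n i) = f (j, i)" for i j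
  proof -
    consider "i < - int n" | "- int n \<le> i" "i \<le> int n" | "int n < i" by linarith
    then show ?thesis
    proof cases
      case 1
      then have c: "clamp_int n i = - int n" by (simp add: clamp_int_def)
      show ?thesis using grid_path_const[OF assms, of i "- int n" j] 1 unfolding c by (simp add: block_def)
    next
      case 2
      then show ?thesis by (simp add: clamp_int_def)
    next
      case 3
      then have c: "clamp_int n i = int n" by (simp add: clamp_int_def)
      show ?thesis using grid_path_const[OF assms, of "int n" i j] 3 unfolding c by (simp add: block_def)
    qed
  qed
  show ?thesis using 1[of i "clamp_int n j"] 1[of j i] by simp
qed

lemma clamp_int_step: "clamp_int n (i + 1) = (if block n i = 1 then clamp_int n i + 1 else clamp_int n i)"
  by (auto simp: clamp_int_def block_def)

text \<open>Squares are numbered so that every size \<open>n \<ge> 1\<close> is taken infinitely often.\<close>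

definition block_size :: "nat \<Rightarrow> nat" where
  "block_size m = Suc (fst (prod_decode m))"

text \<open>The \<open>\<ell>\<^sub>\<infinity>\<close>-sum of the spaces of Lipschitz functions on the squares; the first argument of \<open>u\<close> is the
  number of the square.\<close>

definition blocks :: "real \<Rightarrow> (nat \<times> int \<times> int \<Rightarrow> real) \<Rightarrow> bool" where
  "blocks C u \<longleftrightarrow> (\<forall>m. grid (block (block_size m)) C (\<lambda>x. u (m, x)))"

lemma blocksD: "blocks C u \<Longrightarrow> grid (block (block_size m)) C (\<lambda>x. u (m, x))"
  by (simp add: blocks_def)

lemma ball_family_blocks: "ball_family blocks"
proof -
  have g: "ball_family (grid (block n))" for n by (rule ball_family_grid) (simp add: block_def)
  show ?thesis
    unfolding ball_family_def
  proof (intro conjI allI impI)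
    fix C f assume "blocks C f"
    then show "0 \<le> C" by (rule gridD(1)[OF blocksD])
  next
    fix C D f assume "blocks C f" "C \<le> D"
    then show "blocks D f" unfolding blocks_def using ball_familyD(2)[OF g] by blast
  next
    fix C D f h assume *: "blocks C f" "blocks D h"
    show "blocks (C + D) (f + h)" "blocks (C + D) (f - h)"
      using ball_familyD(3,4)[OF g, OF *[THEN blocksD]] unfolding blocks_def
      by (auto simp: plus_fun_def fun_diff_def)
  qed
qed

text \<open>Distributes the squares of each size over countably many copies of the whole family.\<close>

definition block_shift :: "nat \<times> nat \<times> 'p \<Rightarrow> nat \<times> 'p" where
  "block_shift = (\<lambda>(t, m, x). case prod_decode m of (n, l) \<Rightarrow> (prod_encode (n, prod_encode (t, l)), x))"

lemma bij_block_shift: "bij block_shift"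
proof (rule bij_betw_byWitness[where f' = "\<lambda>(m, x). case prod_decode m of (n, l) \<Rightarrow>
    case prod_decode l of (t, l) \<Rightarrow> (t, prod_encode (n, l), x)"])
  show "\<forall>a\<in>UNIV. block_shift (case a of (m, x) \<Rightarrow> case prod_decode m of (n, l) \<Rightarrow>
      case prod_decode l of (t, l) \<Rightarrow> (t, prod_encode (n, l), x)) = (a :: nat \<times> 'a)"
    by (auto simp: block_shift_def split: prod.split) (metis prod_decode_inverse)
qed (auto simp: block_shift_def split: prod.split, metis prod_decode_inverse)

lemma blocks_shift: "blocks C v \<longleftrightarrow> (\<forall>t. blocks C (\<lambda>p. v (block_shift (t, p))))"
proof
  assume v: "blocks C v"
  have "grid (block (block_size m)) C (\<lambda>x. v (block_shift (t, m, x)))" for t m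
    using blocksD[OF v, of "fst (block_shift (t, m, ()))"]
    by (auto simp: block_shift_def block_size_def split: prod.splits)
  then show "\<forall>t. blocks C (\<lambda>p. v (block_shift (t, p)))" unfolding blocks_def by blast
next
  assume v: "\<forall>t. blocks C (\<lambda>p. v (block_shift (t, p)))"
  have "grid (block (block_size m)) C (\<lambda>x. v (m, x))" for m
  proof -
    obtain n l where m: "m = prod_encode (n, l)" by (metis prod_decode_inverse surj_pair)
    obtain t l' where l: "l = prod_encode (t, l')" by (metis prod_decode_inverse surj_pair)
    have "grid (block (block_size (prod_encode (n, l')))) C (\<lambda>x. v (block_shift (t, prod_encode (n, l'), x)))"
      using v blocksD by blast
    then show ?thesis by (simp add: block_shift_def block_size_def m l)
  qed
  then show "blocks C v" unfolding blocks_def by blast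
qed

section \<open>The full grid is complemented in the sum of the squares\<close>

text \<open>A radial cutoff: \<open>1\<close> up to \<open>2^k\<close>, \<open>0\<close> from \<open>2^(k + 1)\<close> on, and affine in between.\<close>

definition cutoff :: "nat \<Rightarrow> nat \<Rightarrow> real" where
  "cutoff k t = max 0 (min 1 (2 - real t / 2 ^ k))"

text \<open>The partition of unity given by the differences of the cutoffs. For \<open>k > 0\<close> the function \<open>annulus k\<close> lives
  between \<open>2^(k - 1)\<close> and \<open>2^(k + 1)\<close>.\<close>

fun annulus :: "nat \<Rightarrow> nat \<Rightarrow> real" where
  "annulus 0 t = cutoff 0 t"
| "annulus (Suc k) t = cutoff (Suc k) t - cutoff k t"

lemma cutoff_eq_1: "t \<le> 2 ^ k \<Longrightarrow> cutoff k t = 1"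
proof -
  assume "t \<le> 2 ^ k"
  then have "real t \<le> 2 ^ k" by (metis of_nat_le_iff of_nat_numeral of_nat_power)
  then show ?thesis by (simp add: cutoff_def)
qed

lemma cutoff_eq_0: "2 ^ Suc k \<le> t \<Longrightarrow> cutoff k t = 0"
proof -
  assume "2 ^ Suc k \<le> t"
  then have "2 ^ Suc k \<le> real t" by (metis of_nat_le_iff of_nat_numeral of_nat_power)
  then have "2 \<le> real t / 2 ^ k" by (simp add: le_divide_eq)
  then show ?thesis by (simp add: cutoff_def)
qed

lemma annulus_nonneg: "0 \<le> annulus k t"
proof (cases k)
  case (Suc l)
  have "real t / 2 ^ Suc l \<le> real t / 2 ^ l" by (intro divide_left_mono) auto
  then show ?thesis by (simp only: Suc annulus.simps cutoff_def)
qed (simp add: cutoff_def)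

lemma sum_annulus: "(\<Sum>k\<le>n. annulus k t) = cutoff n t"
  by (induction n) auto

lemma sum_annulus_1: "t \<le> n \<Longrightarrow> (\<Sum>k\<le>n. annulus k t) = 1"
  unfolding sum_annulus using less_exp[of n] by (intro cutoff_eq_1) linarith

lemma annulus_eq_0:
  assumes "t < k"
  shows "annulus k t = 0"
proof -
  obtain l where l: "k = Suc l" using assms by (cases k) auto
  have "t \<le> 2 ^ l" using assms l less_exp[of l] by linarith
  moreover from this have "t \<le> 2 ^ Suc l" by simp
  ultimately show ?thesis unfolding l annulus.simps by (simp only: cutoff_eq_1)
qed

lemma annulus_eq_0_outside:
  assumes "2 ^ Suc k \<le> t"
  shows "annulus k t = 0"
proof (cases k)
  case 0 then show ?thesis using cutoff_eq_0[OF assms] by simp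
next
  case (Suc l)
  have "2 ^ Suc l \<le> t" using assms unfolding Suc by simp
  then show ?thesis using cutoff_eq_0[OF assms] cutoff_eq_0[of l t] unfolding Suc by simp
qed

text \<open>The dyadic intervals on which the cutoffs vary do not overlap, so between neighbouring integers at most
  one cutoff changes, and by at most the inverse of the length of its interval.\<close>

lemma cutoff_variation:
  assumes "s \<le> Suc t" "t \<le> Suc s"
  shows "(\<Sum>k\<le>n. \<bar>cutoff k s - cutoff k t\<bar>) * t \<le> 2"
proof -
  consider "s = t" | "s \<le> 1" "t \<le> 1" | a where "1 \<le> a" "{s, t} = {a, Suc a}"
  proof (cases "s = t \<or> min s t = 0")
    case True
    then show ?thesis using that(1,2) assms by linarith
  next
    case False
    then have "1 \<le> min s t" "{s, t} = {min s t, Suc (min s t)}" using assms by auto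
    then show ?thesis by (rule that(3))
  qed
  then show ?thesis
  proof cases
    case 1 then show ?thesis by simp
  next
    case 2
    have "cutoff k s = 1" "cutoff k t = 1" for k
      using 2 by (auto intro!: cutoff_eq_1 order_trans[OF _ one_le_power])
    then show ?thesis by simp
  next
    case 3
    obtain e where e: "2 ^ e \<le> a" "a < 2 ^ (e + 1)" using ex_power_ivl1[of 2 a] \<open>1 \<le> a\<close> by auto
    have other: "cutoff k (Suc a) = cutoff k a" if "k \<noteq> e" for k
    proof (cases "k < e")
      case True
      then have "(2::nat) ^ Suc k \<le> 2 ^ e" by (intro power_increasing) auto
      then show ?thesis using e by (simp only: cutoff_eq_0)
    next
      case False
      then have "(2::nat) ^ (e + 1) \<le> 2 ^ k" using that by (intro power_increasing) auto
      then show ?thesis using e by (simp only: cutoff_eq_1)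
    qed
    have "\<bar>cutoff e (Suc a) - cutoff e a\<bar> \<le> \<bar>(2 - real (Suc a) / 2 ^ e) - (2 - real a / 2 ^ e)\<bar>"
      unfolding cutoff_def by linarith
    also have "\<dots> = 1 / 2 ^ e" by (simp add: add_divide_distrib)
    finally have at_e: "\<bar>cutoff e (Suc a) - cutoff e a\<bar> \<le> 1 / 2 ^ e" .
    have st: "\<bar>cutoff k s - cutoff k t\<bar> = \<bar>cutoff k (Suc a) - cutoff k a\<bar>" for k
      using 3(2) by (auto simp: doubleton_eq_iff abs_minus_commute)
    have "(\<Sum>k\<le>n. \<bar>cutoff k s - cutoff k t\<bar>) \<le> (\<Sum>k\<le>n. if k = e then 1 / 2 ^ e else 0)"
      unfolding st by (intro sum_mono) (use other at_e in auto)
    also have "\<dots> \<le> 1 / 2 ^ e" by simp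
    finally have "(\<Sum>k\<le>n. \<bar>cutoff k s - cutoff k t\<bar>) * t \<le> 1 / 2 ^ e * t"
      by (rule mult_right_mono) simp
    also have "\<dots> \<le> 1 / 2 ^ e * 2 ^ (e + 1)"
    proof -
      have "t \<le> 2 ^ (e + 1)" using 3(2) e by (auto simp: doubleton_eq_iff)
      then have "real t \<le> 2 ^ (e + 1)" by (metis of_nat_le_iff of_nat_numeral of_nat_power)
      then show ?thesis by (intro mult_left_mono) auto
    qed
    finally show ?thesis by simp
  qed
qed

lemma annulus_variation:
  assumes "s \<le> Suc t" "t \<le> Suc s"
  shows "(\<Sum>k\<le>n. \<bar>annulus k s - annulus k t\<bar>) * t \<le> 4"
proof -
  have "(\<Sum>k\<le>n. \<bar>annulus k s - annulus k t\<bar>) \<le> 2 * (\<Sum>k\<le>n. \<bar>cutoff k s - cutoff k t\<bar>)"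
  proof -
    have "(\<Sum>k\<le>n. \<bar>annulus k s - annulus k t\<bar>) + \<bar>cutoff n s - cutoff n t\<bar>
        \<le> 2 * (\<Sum>k\<le>n. \<bar>cutoff k s - cutoff k t\<bar>)"
      by (induction n) auto
    then show ?thesis by linarith
  qed
  then have "(\<Sum>k\<le>n. \<bar>annulus k s - annulus k t\<bar>) * t \<le> 2 * (\<Sum>k\<le>n. \<bar>cutoff k s - cutoff k t\<bar>) * t"
    by (rule mult_right_mono) simp
  then show ?thesis using cutoff_variation[OF assms, of n] by simp
qed

text \<open>The distance from the origin in the maximum norm.\<close>

definition radius :: "int \<times> int \<Rightarrow> nat" where
  "radius x = nat (max \<bar>fst x\<bar> \<bar>snd x\<bar>)"

lemma radius_step:
  "radius (i + 1, j) \<le> Suc (radius (i, j))" "radius (i, j) \<le> Suc (radius (i + 1, j))"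
  "radius (i, j + 1) \<le> Suc (radius (i, j))" "radius (i, j) \<le> Suc (radius (i, j + 1))"
  by (auto simp: radius_def)

lemma grid_1_bound:
  assumes "grid (\<lambda>_. 1) C f"
  shows "\<bar>f x\<bar> \<le> 2 * C * radius x"
proof -
  have path: "\<bar>g (i, j) - g (0, j)\<bar> \<le> C * \<bar>i\<bar>" if "grid (\<lambda>_. 1) C g" for g i j
    using grid_path(1)[OF that, of 0 i j] grid_path(1)[OF that, of i 0 j] by (cases "0 \<le> i") auto
  obtain i j where x: "x = (i, j)" by fastforce
  have "\<bar>f (i, j) - f (0, j)\<bar> \<le> C * \<bar>i\<bar>" "\<bar>f (0, j) - f (0, 0)\<bar> \<le> C * \<bar>j\<bar>"
    using path[OF assms, of i j] path[OF grid_swap[OF assms], of j 0] by auto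
  moreover have "C * \<bar>i\<bar> \<le> C * radius x" "C * \<bar>j\<bar> \<le> C * radius x"
    using gridD(1)[OF assms] by (auto simp: x radius_def intro!: mult_left_mono)
  ultimately show ?thesis using gridD(2)[OF assms] by (simp add: x)
qed

text \<open>The functions \<open>u k\<close> glued along the dyadic annuli. Truncating the sum at \<open>radius x\<close> loses nothing and keeps
  it finite.\<close>

definition annular_sum :: "(nat \<Rightarrow> int \<times> int \<Rightarrow> real) \<Rightarrow> int \<times> int \<Rightarrow> real" where
  "annular_sum u x = (\<Sum>k\<le>radius x. annulus k (radius x) * u k x)"

lemma annular_sum_upto:
  assumes "radius x \<le> n"
  shows "annular_sum u x = (\<Sum>k\<le>n. annulus k (radius x) * u k x)"
  unfolding annular_sum_def
  by (rule sum.mono_neutral_left) (use assms in \<open>auto simp: annulus_eq_0\<close>)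

text \<open>By the product rule: the increments of the \<open>u k\<close> contribute a convex combination, and those of the
  partition of unity are compensated by the linear growth of \<open>u k\<close>, which vanishes at the origin.\<close>

lemma annular_sum_step:
  assumes u: "\<And>k. grid (\<lambda>_. 1) C (u k)" and step: "\<And>k. \<bar>u k x - u k y\<bar> \<le> C"
    and r: "radius x \<le> Suc (radius y)" "radius y \<le> Suc (radius x)"
  shows "\<bar>annular_sum u x - annular_sum u y\<bar> \<le> 9 * C"
proof -
  let ?n = "max (radius x) (radius y)"
  have C: "0 \<le> C" by (rule gridD(1)[OF u])
  have "annular_sum u x - annular_sum u y =
      (\<Sum>k\<le>?n. annulus k (radius x) * (u k x - u k y) + (annulus k (radius x) - annulus k (radius y)) * u k y)"
    by (simp add: annular_sum_upto[of _ ?n] sum_subtractf[symmetric] algebra_simps)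
  also have "\<bar>\<dots>\<bar> \<le> (\<Sum>k\<le>?n. annulus k (radius x) * C + \<bar>annulus k (radius x) - annulus k (radius y)\<bar> * (2 * C * radius y))"
  proof (rule order_trans[OF sum_abs], rule sum_mono)
    fix k
    have "\<bar>annulus k (radius x) * (u k x - u k y)\<bar> \<le> annulus k (radius x) * C"
      using step[of k] annulus_nonneg by (simp add: abs_mult mult_left_mono)
    moreover have "\<bar>(annulus k (radius x) - annulus k (radius y)) * u k y\<bar>
        \<le> \<bar>annulus k (radius x) - annulus k (radius y)\<bar> * (2 * C * radius y)"
      unfolding abs_mult by (intro mult_left_mono grid_1_bound[OF u]) simp
    ultimately show "\<bar>annulus k (radius x) * (u k x - u k y) + (annulus k (radius x) - annulus k (radius y)) * u k y\<bar>
        \<le> annulus k (radius x) * C + \<bar>annulus k (radius x) - annulus k (radius y)\<bar> * (2 * C * radius y)"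
      by linarith
  qed
  also have "\<dots> = (\<Sum>k\<le>?n. annulus k (radius x)) * C
      + 2 * C * ((\<Sum>k\<le>?n. \<bar>annulus k (radius x) - annulus k (radius y)\<bar>) * radius y)"
    by (simp add: sum.distrib sum_distrib_right sum_distrib_left mult_ac)
  also have "\<dots> \<le> 1 * C + 2 * C * 4"
    by (intro add_mono mult_left_mono annulus_variation r) (use C in \<open>simp_all add: sum_annulus_1\<close>)
  finally show ?thesis by simp
qed

lemma annular_sum_grid:
  assumes u: "\<And>k. grid (\<lambda>_. 1) C (u k)"
  shows "grid (\<lambda>_. 1) (9 * C) (annular_sum u)"
proof (rule gridI)
  show "0 \<le> 9 * C" using gridD(1)[OF u] by simp
  show "annular_sum u (0, 0) = 0" using gridD(2)[OF u] by (simp add: annular_sum_def)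
  fix i j
  show "\<bar>annular_sum u (i + 1, j) - annular_sum u (i, j)\<bar> \<le> 9 * C * 1"
    using annular_sum_step[of C u "(i + 1, j)" "(i, j)", OF u] gridD(3)[OF u, of _ i j] radius_step by simp
  show "\<bar>annular_sum u (i, j + 1) - annular_sum u (i, j)\<bar> \<le> 9 * C * 1"
    using annular_sum_step[of C u "(i, j + 1)" "(i, j)", OF u] gridD(4)[OF u, of _ i j] radius_step by simp
qed

lemma grid_mono_weight:
  assumes "grid v C f" "\<And>i. v i \<le> w i"
  shows "grid w C f"
proof -
  have "C * v i \<le> C * w i" for i using assms(2) gridD(1)[OF assms(1)] by (intro mult_left_mono) auto
  then show ?thesis using assms(1) unfolding grid_def by (meson order_trans)
qed

theorem grid_complemented_in_blocks: "complemented (grid (\<lambda>_. 1)) blocks"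
proof -
  \<comment> \<open>a square that contains the support of \<open>annulus k\<close>\<close>
  define \<mu> where "\<mu> k = prod_encode (2 ^ Suc k, 0)" for k :: nat
  define E :: "(int \<times> int \<Rightarrow> real) \<Rightarrow> nat \<times> int \<times> int \<Rightarrow> real" where
    "E f = (\<lambda>(m, i, j). f (clamp_int (block_size m) i, clamp_int (block_size m) j))" for f
  define R :: "(nat \<times> int \<times> int \<Rightarrow> real) \<Rightarrow> int \<times> int \<Rightarrow> real" where
    "R u = annular_sum (\<lambda>k x. u (\<mu> k, x))" for u
  have E: "bounded_op (grid (\<lambda>_. 1)) blocks E"
  proof (rule bounded_opI[where K = 1])
    fix x show "(\<lambda>f. E f x) \<in> finite_functionals"
      by (cases x) (auto simp: E_def intro: finite_functional_eval)
  next
    fix C f assume f: "grid (\<lambda>_. 1) C f"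
    have c0: "clamp_int n 0 = 0" for n by (simp add: clamp_int_def)
    have "grid (block n) C (\<lambda>(i, j). f (clamp_int n i, clamp_int n j))" for n
      by (rule gridI) (use gridD[OF f] in \<open>auto simp: clamp_int_step c0 block_def\<close>)
    then show "blocks (1 * C) (E f)" unfolding blocks_def E_def by (simp add: case_prod_unfold)
  qed simp
  have R: "bounded_op blocks (grid (\<lambda>_. 1)) R"
  proof (rule bounded_opI[where K = 9])
    fix x show "(\<lambda>u. R u x) \<in> finite_functionals"
      unfolding R_def annular_sum_def by (intro finite_functional_intros)
  next
    fix C u assume u: "blocks C u"
    have "grid (\<lambda>_. 1) C (\<lambda>x. u (\<mu> k, x))" for k
      by (rule grid_mono_weight[OF blocksD[OF u]]) (simp add: block_def)
    then show "grid (\<lambda>_. 1) (9 * C) (R u)" unfolding R_def by (rule annular_sum_grid)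
  qed simp
  have RE: "R (E f) = f" for f
  proof
    fix x :: "int \<times> int"
    obtain i j where x: "x = (i, j)" by fastforce
    have "annulus k (radius x) * E f (\<mu> k, x) = annulus k (radius x) * f x" for k
    proof (cases "radius x < 2 ^ Suc k")
      case True
      then have "radius x \<le> block_size (\<mu> k)" by (simp add: block_size_def \<mu>_def)
      then have "clamp_int (block_size (\<mu> k)) i = i" "clamp_int (block_size (\<mu> k)) j = j"
        by (auto simp: x radius_def clamp_int_def)
      then show ?thesis by (simp add: E_def x)
    next
      case False
      then show ?thesis by (simp add: annulus_eq_0_outside)
    qed
    then have "R (E f) x = (\<Sum>k\<le>radius x. annulus k (radius x)) * f x"
      unfolding R_def annular_sum_def sum_distrib_right by (simp only:)
    then show "R (E f) x = f x" by (simp add: sum_annulus_1)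
  qed
  show ?thesis unfolding complemented_def
    by (intro exI[of _ E] exI[of _ R] conjI allI impI E R RE)
qed

section \<open>Grids with integer weights are complemented in the full grid\<close>

text \<open>For positive lengths \<open>W 0, W 1, \<dots>\<close> of consecutive intervals, the natural number \<open>x\<close> is
  the point number \<open>t\<close> of the interval number \<open>i\<close>, where \<open>(i, t) = cell W x\<close>.\<close>

fun cell :: "(nat \<Rightarrow> nat) \<Rightarrow> nat \<Rightarrow> nat \<times> nat" where
  "cell W 0 = (0, 0)"
| "cell W (Suc x) = (case cell W x of (i, t) \<Rightarrow> if Suc t < W i then (i, Suc t) else (Suc i, 0))"

text \<open>The left endpoint of the interval number \<open>i\<close>.\<close>

definition knot :: "(nat \<Rightarrow> nat) \<Rightarrow> nat \<Rightarrow> nat" where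
  "knot W i = sum W {..<i}"

text \<open>The lengths as a weight on the integers; functions in \<open>grid (weight W)\<close> are constant to the left of \<open>0\<close>.\<close>

definition weight :: "(nat \<Rightarrow> nat) \<Rightarrow> int \<Rightarrow> real" where
  "weight W i = (if i < 0 then 0 else real (W (nat i)))"

text \<open>The piecewise affine function that takes the value \<open>g i\<close> at the knot number \<open>i \<ge> 0\<close>, and \<open>g 0\<close> at the negative
  integers.\<close>

definition interp :: "(nat \<Rightarrow> nat) \<Rightarrow> (int \<Rightarrow> real) \<Rightarrow> int \<Rightarrow> real" where
  "interp W g x = (case cell W (nat x) of (i, t) \<Rightarrow>
     g (int i) + real t / real (W i) * (g (int i + 1) - g (int i)))"

lemma interp_diff: "interp W g x - interp W h x = interp W (\<lambda>i. g i - h i) x"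
  by (simp add: interp_def algebra_simps split: prod.split)

lemma interp_0: "x \<le> 0 \<Longrightarrow> interp W g x = g 0"
  by (simp add: interp_def)

context
  fixes W :: "nat \<Rightarrow> nat"
  assumes W: "\<And>i. 0 < W i"
begin

lemma cell_less: "cell W x = (i, t) \<Longrightarrow> t < W i"
  by (induction x arbitrary: i t) (auto simp: W split: prod.splits if_splits)

lemma cell_knot: "cell W (knot W i) = (i, 0)"
proof (induction i)
  case 0
  then show ?case by (simp add: knot_def)
next
  case (Suc i)
  have "cell W (knot W i + t) = (i, t)" if "t < W i" for t
    using that by (induction t) (simp_all add: Suc)
  moreover obtain k where k: "W i = Suc k" using W[of i] gr0_conv_Suc by blast
  ultimately have "cell W (Suc (knot W i + k)) = (Suc i, 0)" by simp
  moreover have "Suc (knot W i + k) = knot W (Suc i)" by (simp add: knot_def k)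
  ultimately show ?case by simp
qed

lemma interp_knot: "0 \<le> i \<Longrightarrow> interp W g (int (knot W (nat i))) = g i"
  by (simp add: interp_def cell_knot)

lemma interp_step:
  assumes "0 \<le> x" and c: "cell W (nat x) = (i, t)"
  shows "interp W g (x + 1) - interp W g x = (g (int i + 1) - g (int i)) / W i"
proof -
  have n: "nat (x + 1) = Suc (nat x)" using assms(1) by simp
  have c': "cell W (nat (x + 1)) = (if Suc t < W i then (i, Suc t) else (Suc i, 0))"
    by (simp only: n cell.simps c prod.case)
  have t: "t < W i" by (rule cell_less[OF c])
  show ?thesis
  proof (cases "Suc t < W i")
    case True
    then show ?thesis unfolding interp_def c c' by (simp add: algebra_simps add_divide_distrib diff_divide_distrib)
  next
    case False
    then have "real (W i) = real t + 1" using t by linarith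
    then show ?thesis using False unfolding interp_def c c' by (simp add: divide_simps) (simp add: algebra_simps)
  qed
qed

lemma interp_bound:
  assumes "\<And>i. \<bar>g i\<bar> \<le> B"
  shows "\<bar>interp W g x\<bar> \<le> B"
proof -
  obtain i t where c: "cell W (nat x) = (i, t)" by fastforce
  define \<theta> where "\<theta> = real t / real (W i)"
  have \<theta>: "0 \<le> \<theta>" "\<theta> \<le> 1" using cell_less[OF c] by (auto simp: \<theta>_def divide_le_eq)
  have "interp W g x = (1 - \<theta>) * g (int i) + \<theta> * g (int i + 1)"
    by (simp add: interp_def c \<theta>_def algebra_simps)
  also have "\<bar>\<dots>\<bar> \<le> (1 - \<theta>) * \<bar>g (int i)\<bar> + \<theta> * \<bar>g (int i + 1)\<bar>"
    using \<theta> by (intro order_trans[OF abs_triangle_ineq]) (simp add: abs_mult)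
  also have "\<dots> \<le> (1 - \<theta>) * B + \<theta> * B"
    using \<theta> assms by (intro add_mono mult_left_mono) auto
  finally show ?thesis by (simp add: algebra_simps)
qed

lemma interp_lipschitz:
  assumes "\<And>i. \<bar>g (i + 1) - g i\<bar> \<le> C * weight W i" and "0 \<le> C"
  shows "\<bar>interp W g (x + 1) - interp W g x\<bar> \<le> C"
proof (cases "0 \<le> x")
  case True
  obtain i t where c: "cell W (nat x) = (i, t)" by fastforce
  have "\<bar>g (int i + 1) - g (int i)\<bar> \<le> C * W i" using assms(1)[of "int i"] by (simp add: weight_def)
  then show ?thesis unfolding interp_step[OF True c] using W[of i] by (simp add: divide_le_eq)
qed (use assms(2) in \<open>simp add: interp_0\<close>)

text \<open>Interpolate in both coordinates, and restrict to the knots. An increment of the interpolant in one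
  coordinate is a convex combination, over the other coordinate, of slopes of the given function.\<close>

theorem weighted_grid_complemented: "complemented (grid (weight W)) (grid (\<lambda>_. 1))"
proof -
  define E :: "(int \<times> int \<Rightarrow> real) \<Rightarrow> int \<times> int \<Rightarrow> real" where
    "E f = (\<lambda>(x, y). interp W (\<lambda>i. interp W (\<lambda>j. f (i, j)) y) x)" for f
  define R :: "(int \<times> int \<Rightarrow> real) \<Rightarrow> int \<times> int \<Rightarrow> real" where
    "R F = (\<lambda>(i, j). F (int (knot W (nat i)), int (knot W (nat j))))" for F
  have E: "bounded_op (grid (weight W)) (grid (\<lambda>_. 1)) E"
  proof (rule bounded_opI[where K = 1])
    fix x :: "int \<times> int"
    show "(\<lambda>f. E f x) \<in> finite_functionals"
      unfolding E_def interp_def case_prod_unfold by (intro finite_functional_intros)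
  next
    fix C f assume f: "grid (weight W) C f"
    have C: "0 \<le> C" by (rule gridD(1)[OF f])
    show "grid (\<lambda>_. 1) (1 * C) (E f)"
    proof (rule gridI)
      show "E f (0, 0) = 0" using gridD(2)[OF f] by (simp add: E_def interp_0)
    next
      fix x y
      have "\<bar>interp W (\<lambda>j. f (i + 1, j)) y - interp W (\<lambda>j. f (i, j)) y\<bar> \<le> C * weight W i" for i
        unfolding interp_diff by (intro interp_bound gridD(3)[OF f])
      then show "\<bar>E f (x + 1, y) - E f (x, y)\<bar> \<le> 1 * C * 1"
        unfolding E_def using interp_lipschitz[OF _ C] by simp
      have "\<bar>interp W (\<lambda>j. f (i, j)) (y + 1) - interp W (\<lambda>j. f (i, j)) y\<bar> \<le> C" for i
        by (intro interp_lipschitz gridD(4)[OF f] C)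
      then show "\<bar>E f (x, y + 1) - E f (x, y)\<bar> \<le> 1 * C * 1"
        unfolding E_def prod.case interp_diff using interp_bound by simp
    qed (use C in simp)
  qed simp
  have R: "bounded_op (grid (\<lambda>_. 1)) (grid (weight W)) R"
  proof (rule bounded_opI[where K = 1])
    fix x :: "int \<times> int"
    show "(\<lambda>f. R f x) \<in> finite_functionals"
      unfolding R_def case_prod_unfold by (intro finite_functional_intros)
  next
    fix C F assume F: "grid (\<lambda>_. 1) C F"
    have knots: "int (knot W (nat i)) \<le> int (knot W (nat (i + 1)))"
      "sum (\<lambda>_. 1) {int (knot W (nat i))..<int (knot W (nat (i + 1)))} = weight W i" for i
    proof -
      have "int (knot W (nat (i + 1))) = int (knot W (nat i)) + (if i < 0 then 0 else int (W (nat i)))"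
        by (cases "i < 0") (simp_all add: knot_def nat_add_distrib)
      then show "int (knot W (nat i)) \<le> int (knot W (nat (i + 1)))"
        "sum (\<lambda>_. 1) {int (knot W (nat i))..<int (knot W (nat (i + 1)))} = weight W i"
        by (simp_all add: weight_def)
    qed
    show "grid (weight W) (1 * C) (R F)"
    proof (rule gridI)
      show "R F (0, 0) = 0" using gridD(2)[OF F] by (simp add: R_def knot_def)
      fix i j
      show "\<bar>R F (i + 1, j) - R F (i, j)\<bar> \<le> 1 * C * weight W i"
        using grid_path(1)[OF F knots(1)] unfolding knots(2) R_def by simp
      show "\<bar>R F (i, j + 1) - R F (i, j)\<bar> \<le> 1 * C * weight W j"
        using grid_path(2)[OF F knots(1)] unfolding knots(2) R_def by simp
    qed (use gridD(1)[OF F] in simp)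
  qed simp
  have RE: "R (E f) = f" if f: "grid (weight W) C f" for C f
  proof
    fix x :: "int \<times> int"
    obtain i j where x: "x = (i, j)" by fastforce
    have k: "interp W g (int (knot W (nat i))) = g (max 0 i)" for g i
    proof (cases "0 \<le> i")
      case False then show ?thesis by (simp add: knot_def interp_0)
    qed (simp add: interp_knot)
    have "f (max 0 i, j) = f (i, j)" for i j
      using grid_path_const(1)[OF f, of i 0 j] by (cases "0 \<le> i") (simp_all add: weight_def)
    moreover have "f (i, max 0 j) = f (i, j)" for i j
      using grid_path_const(2)[OF f, of j 0 i] by (cases "0 \<le> j") (simp_all add: weight_def)
    ultimately show "R (E f) x = f x" unfolding R_def E_def x by (simp add: k)
  qed
  show ?thesis unfolding complemented_def
    by (intro exI[of _ E] exI[of _ R] conjI allI impI E R) (erule RE)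
qed

end

section \<open>The sum of the squares is complemented in slowly varying grids\<close>

text \<open>The weight is nonnegative, and for a fixed factor \<open>K\<close> there are arbitrarily long intervals, arbitrarily far to the right, on which the
  weight is constant up to \<open>K\<close>.\<close>

definition slow_weight :: "(int \<Rightarrow> real) \<Rightarrow> bool" where
  "slow_weight w \<longleftrightarrow> (\<forall>i. 0 \<le> w i) \<and>
     (\<exists>K\<ge>0. \<forall>n s0. \<exists>s\<ge>s0. \<exists>h>0. \<forall>i. int s \<le> i \<and> i < int (s + n) \<longrightarrow> h \<le> w i \<and> w i \<le> K * h)"

lemma slow_weight_intervals:
  fixes l :: "nat \<Rightarrow> nat"
  assumes "slow_weight w"
  obtains K :: real and h :: "nat \<Rightarrow> real" and s :: "nat \<Rightarrow> nat" where "0 \<le> K" "\<And>m. 0 < h m"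
    "\<And>m i. int (s m) \<le> i \<Longrightarrow> i < int (s m + l m) \<Longrightarrow> h m \<le> w i \<and> w i \<le> K * h m"
    "\<And>m. s m + l m \<le> s (Suc m)"
proof -
  obtain K where K: "0 \<le> K" "\<forall>n s0. \<exists>s. s \<ge> s0 \<and> (\<exists>h>0. \<forall>i. int s \<le> i \<and> i < int (s + n) \<longrightarrow> h \<le> w i \<and> w i \<le> K * h)"
    using assms unfolding slow_weight_def by auto
  obtain S where S: "\<And>n s0. S n s0 \<ge> s0"
    "\<And>n s0. \<exists>h>0. \<forall>i. int (S n s0) \<le> i \<and> i < int (S n s0 + n) \<longrightarrow> h \<le> w i \<and> w i \<le> K * h"
    using K(2) by metis
  define s where "s = rec_nat (S (l 0) 0) (\<lambda>m x. S (l (Suc m)) (x + l m))"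
  have "\<exists>x. s m = S (l m) x" for m by (cases m) (auto simp: s_def)
  then have "\<forall>m. \<exists>h>0. \<forall>i. int (s m) \<le> i \<and> i < int (s m + l m) \<longrightarrow> h \<le> w i \<and> w i \<le> K * h"
    using S(2) by metis
  then obtain h where h: "\<And>m. 0 < h m \<and> (\<forall>i. int (s m) \<le> i \<and> i < int (s m + l m) \<longrightarrow> h m \<le> w i \<and> w i \<le> K * h m)"
    by metis
  have "s m + l m \<le> s (Suc m)" for m using S(1) by (simp add: s_def)
  then show ?thesis using that[OF K(1), of h s] h by blast
qed

lemma intervals_ordered:
  fixes s l :: "nat \<Rightarrow> nat"
  assumes step: "\<And>m. s m + l m \<le> s (Suc m)" and "m < m'"
  shows "s m + l m \<le> s m'"
  using \<open>m < m'\<close>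
proof (induction m')
  case (Suc k)
  then show ?case using step[of k] step[of m] by (cases "m = k") auto
qed simp

lemma grid_block_const:
  assumes f: "grid (block n) C f"
  shows "i \<le> - int n \<Longrightarrow> j \<le> - int n \<Longrightarrow> f (i, j) = f (- int n, - int n)"
    "int n \<le> i \<Longrightarrow> int n \<le> j \<Longrightarrow> f (i, j) = f (int n, int n)"
proof -
  assume "i \<le> - int n" "j \<le> - int n"
  then have "clamp_int n i = - int n" "clamp_int n j = - int n" by (auto simp: clamp_int_def)
  then show "f (i, j) = f (- int n, - int n)" using grid_block_clamp[OF f, of i j] by simp
next
  assume "int n \<le> i" "int n \<le> j"
  then have "clamp_int n i = int n" "clamp_int n j = int n" by (auto simp: clamp_int_def)
  then show "f (i, j) = f (int n, int n)" using grid_block_clamp[OF f, of i j] by simp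
qed

text \<open>The square number \<open>m\<close> is put over \<open>[s m, s m + 2 n]\<close> in both coordinates, where \<open>n = block_size m\<close> and
  these intervals are disjoint up to endpoints.\<close>

theorem blocks_complemented_in_grid:
  assumes w: "slow_weight w"
  shows "complemented blocks (grid w)"
proof -
  let ?N = block_size
  have w0: "0 \<le> w i" for i using w by (simp add: slow_weight_def)
  obtain K h s where K: "0 \<le> K" and h: "\<And>m. 0 < h m"
    and hw: "\<And>m i. int (s m) \<le> i \<Longrightarrow> i < int (s m + 2 * ?N m) \<Longrightarrow> h m \<le> w i \<and> w i \<le> K * h m"
    and step: "\<And>m. s m + 2 * ?N m \<le> s (Suc m)"
    by (rule slow_weight_intervals[OF w, of "\<lambda>m. 2 * ?N m"]) (rule that)
  have ordered: "s m + 2 * ?N m \<le> s m'" if "m < m'" for m m' by (rule intervals_ordered[where s = s and l = "\<lambda>m. 2 * ?N m", OF step that])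
  have s_ge: "m \<le> s m" for m
  proof (induction m)
    case (Suc m)
    then show ?case using step[of m] by (simp add: block_size_def)
  qed simp
  define c where "c m = int (s m + ?N m)" for m
  \<comment> \<open>The contribution of one square. No clamping appears, as functions on a square are constant beyond it; the value
    at the lower left corner is subtracted so that only finitely many terms are nonzero at each point.\<close>
  define T :: "nat \<Rightarrow> (nat \<times> int \<times> int \<Rightarrow> real) \<Rightarrow> int \<times> int \<Rightarrow> real" where
    "T m u = (\<lambda>(x, y). h m * (u (m, x - c m, y - c m) - u (m, - int (?N m), - int (?N m))))" for m u
  define J :: "(nat \<times> int \<times> int \<Rightarrow> real) \<Rightarrow> int \<times> int \<Rightarrow> real" where
    "J u = (\<lambda>p. \<Sum>m\<le>nat (max (fst p) (snd p)). T m u p)" for u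
  define R :: "(int \<times> int \<Rightarrow> real) \<Rightarrow> nat \<times> int \<times> int \<Rightarrow> real" where
    "R f = (\<lambda>(m, x, y). (f (c m + clamp_int (?N m) x, c m + clamp_int (?N m) y) - f (c m, c m)) / h m)" for f

  have T_low: "T m u (x, y) = 0" if u: "blocks C u" and "x \<le> int (s m)" "y \<le> int (s m)" for C u m x y
    using grid_block_const(1)[OF blocksD[OF u], of "x - c m" m "y - c m"] that by (simp add: T_def c_def)
  have J_upto: "J u (x, y) = (\<Sum>m\<le>M. T m u (x, y))" if u: "blocks C u" and "x \<le> int M" "y \<le> int M" for C u x y M
    unfolding J_def
  proof (rule sum.mono_neutral_left)
    show "\<forall>m\<in>{..M} - {..nat (max (fst (x, y)) (snd (x, y)))}. T m u (x, y) = 0"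
    proof
      fix m assume "m \<in> {..M} - {..nat (max (fst (x, y)) (snd (x, y)))}"
      then have "x \<le> int (s m)" "y \<le> int (s m)" using s_ge[of m] by auto
      then show "T m u (x, y) = 0" by (rule T_low[OF u])
    qed
  qed (use that in auto)

  \<comment> \<open>At most one summand is nonzero, since the intervals are disjoint.\<close>
  have weights: "(\<Sum>m\<le>M. h m * block (?N m) (x - c m)) \<le> w x" for M x
  proof (cases "\<exists>m. block (?N m) (x - c m) \<noteq> 0")
    case True
    then obtain a where a: "int (s a) \<le> x" "x < int (s a + 2 * ?N a)"
      by (auto simp: block_def c_def split: if_splits)
    have "h m * block (?N m) (x - c m) \<le> (if m = a then h a else 0)" for m
      using ordered[of a m] ordered[of m a] a h[of a]
      by (cases m a rule: linorder_cases) (auto simp: block_def c_def)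
    then have "(\<Sum>m\<le>M. h m * block (?N m) (x - c m)) \<le> (\<Sum>m\<le>M. if m = a then h a else 0)"
      by (rule sum_mono)
    also have "\<dots> \<le> h a" using h[of a] by simp
    also have "\<dots> \<le> w x" using hw[OF a] by simp
    finally show ?thesis .
  qed (simp add: w0)

  have J: "bounded_op blocks (grid w) J"
  proof (rule bounded_opI[where K = 1])
    fix p :: "int \<times> int"
    show "(\<lambda>u. J u p) \<in> finite_functionals"
      unfolding J_def T_def case_prod_unfold by (intro finite_functional_intros)
  next
    fix C u assume u: "blocks C u"
    have C: "0 \<le> C" using gridD(1)[OF blocksD[OF u]] .
    have edge: "\<bar>J u p - J u q\<bar> \<le> C * w z"
      if "\<And>m. \<bar>T m u p - T m u q\<bar> \<le> h m * (C * block (?N m) (z - c m))" for p q z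
    proof -
      define M where "M = nat (max (max (fst p) (snd p)) (max (fst q) (snd q)))"
      have "a \<le> int (nat a)" for a by simp
      then have "max (max (fst p) (snd p)) (max (fst q) (snd q)) \<le> int M" unfolding M_def .
      then have M: "fst p \<le> int M" "snd p \<le> int M" "fst q \<le> int M" "snd q \<le> int M" by (simp_all only: max.bounded_iff)
      have "J u p = (\<Sum>m\<le>M. T m u p)" "J u q = (\<Sum>m\<le>M. T m u q)"
        using J_upto[OF u M(1,2)] J_upto[OF u M(3,4)] by (simp_all only: prod.collapse)
      then have "\<bar>J u p - J u q\<bar> \<le> (\<Sum>m\<le>M. \<bar>T m u p - T m u q\<bar>)"
        by (simp only: sum_subtractf[symmetric] sum_abs)
      also have "\<dots> \<le> (\<Sum>m\<le>M. h m * (C * block (?N m) (z - c m)))" by (intro sum_mono that)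
      also have "\<dots> = C * (\<Sum>m\<le>M. h m * block (?N m) (z - c m))"
        by (simp add: sum_distrib_left mult_ac)
      also have "\<dots> \<le> C * w z" by (intro mult_left_mono weights C)
      finally show ?thesis .
    qed
    have T_diff: "T m u (x, y) - T m u (x', y') = h m * (u (m, x - c m, y - c m) - u (m, x' - c m, y' - c m))"
      for m x y x' y' by (simp add: T_def algebra_simps)
    show "grid w (1 * C) (J u)"
    proof (rule gridI)
      show "J u (0, 0) = 0" using J_upto[OF u, of 0 0 0] T_low[OF u, of 0 0 0] by simp
      fix x y
      show "\<bar>J u (x + 1, y) - J u (x, y)\<bar> \<le> 1 * C * w x"
      proof -
        have "\<bar>T m u (x + 1, y) - T m u (x, y)\<bar> \<le> h m * (C * block (?N m) (x - c m))" for m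
        proof -
          have e: "x + 1 - c m = x - c m + 1" by simp
          show ?thesis unfolding T_diff abs_mult e abs_of_pos[OF h]
            by (intro mult_left_mono gridD(3)[OF blocksD[OF u]] less_imp_le[OF h])
        qed
        then show ?thesis using edge[of "(x + 1, y)" "(x, y)" x] by simp
      qed
      show "\<bar>J u (x, y + 1) - J u (x, y)\<bar> \<le> 1 * C * w y"
      proof -
        have "\<bar>T m u (x, y + 1) - T m u (x, y)\<bar> \<le> h m * (C * block (?N m) (y - c m))" for m
        proof -
          have e: "y + 1 - c m = y - c m + 1" by simp
          show ?thesis unfolding T_diff abs_mult e abs_of_pos[OF h]
            by (intro mult_left_mono gridD(4)[OF blocksD[OF u]] less_imp_le[OF h])
        qed
        then show ?thesis using edge[of "(x, y + 1)" "(x, y)" y] by simp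
      qed
    qed (use C in simp)
  qed simp

  have R: "bounded_op (grid w) blocks R"
  proof (rule bounded_opI[where K = K])
    fix x :: "nat \<times> int \<times> int"
    show "(\<lambda>f. R f x) \<in> finite_functionals"
      unfolding R_def case_prod_unfold by (intro finite_functional_intros)
  next
    fix C f assume f: "grid w C f"
    have C: "0 \<le> C" by (rule gridD(1)[OF f])
    have "grid (block (?N m)) (K * C) (\<lambda>x. R f (m, x))" for m
    proof (rule gridI)
      show "0 \<le> K * C" using K C by simp
      show "R f (m, 0, 0) = 0" by (simp add: R_def clamp_int_def)
      fix i j
      have edge: "\<bar>a - b\<bar> / h m \<le> K * C" if "\<bar>a - b\<bar> \<le> C * w (c m + clamp_int (?N m) i)" "block (?N m) i = 1" for a b i
      proof -
        have "w (c m + clamp_int (?N m) i) \<le> K * h m"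
          using that(2) hw[of m "c m + i"] by (auto simp: block_def clamp_int_def c_def split: if_splits)
        then have "\<bar>a - b\<bar> \<le> C * (K * h m)" using that(1) C by (meson mult_left_mono order_trans)
        then show ?thesis using h[of m] by (simp add: divide_le_eq mult_ac)
      qed
      have diff: "R f (m, x, y) - R f (m, x', y') = (f (c m + clamp_int (?N m) x, c m + clamp_int (?N m) y)
          - f (c m + clamp_int (?N m) x', c m + clamp_int (?N m) y')) / h m" for x y x' y'
        by (simp add: R_def diff_divide_distrib)
      show "\<bar>R f (m, i + 1, j) - R f (m, i, j)\<bar> \<le> K * C * block (?N m) i"
      proof (cases "block (?N m) i = 1")
        case True
        then show ?thesis unfolding diff clamp_int_step
          using edge[OF gridD(3)[OF f] True] h[of m] by (simp add: add.assoc[symmetric])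
      next
        case False
        then have "block (?N m) i = 0" by (simp add: block_def split: if_splits)
        then show ?thesis by (simp add: diff clamp_int_step)
      qed
      show "\<bar>R f (m, i, j + 1) - R f (m, i, j)\<bar> \<le> K * C * block (?N m) j"
      proof (cases "block (?N m) j = 1")
        case True
        then show ?thesis unfolding diff clamp_int_step
          using edge[OF gridD(4)[OF f] True] h[of m] by (simp add: add.assoc[symmetric])
      next
        case False
        then have "block (?N m) j = 0" by (simp add: block_def split: if_splits)
        then show ?thesis by (simp add: diff clamp_int_step)
      qed
    qed
    then show "blocks (K * C) (R f)" by (simp add: blocks_def)
  qed (rule K)

  have RJ: "R (J u) = u" if u: "blocks C u" for C u
  proof
    fix p :: "nat \<times> int \<times> int"
    obtain m x y where p: "p = (m, x, y)" by (metis prod_cases3)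
    define M where "M = s m + 2 * ?N m"
    define x' where "x' = clamp_int (?N m) x"
    define y' where "y' = clamp_int (?N m) y"
    have bounds: "- int (?N m) \<le> x'" "x' \<le> int (?N m)" "- int (?N m) \<le> y'" "y' \<le> int (?N m)"
      by (auto simp: x'_def y'_def clamp_int_def)
    have "m \<le> M" using s_ge[of m] by (simp add: M_def)
    have other: "T k u (c m + x', c m + y') - T k u (c m, c m) = 0" if "k \<noteq> m" for k
    proof (cases "k < m")
      case True
      have high: "int (?N k) \<le> c m + x' - c k" "int (?N k) \<le> c m + y' - c k" "int (?N k) \<le> c m - c k"
        using ordered[OF True] bounds by (auto simp: c_def)
      note const = grid_block_const(2)[OF blocksD[OF u, of k]]
      show ?thesis
        unfolding T_def prod.case const[OF high(1,2)] const[OF high(3,3)] by simp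
    next
      case False
      then have "c m + x' \<le> int (s k)" "c m + y' \<le> int (s k)" "c m \<le> int (s k)"
        using ordered[of m k] that bounds by (auto simp: c_def)
      then show ?thesis by (simp only: T_low[OF u])
    qed
    have "J u (c m + x', c m + y') = (\<Sum>k\<le>M. T k u (c m + x', c m + y'))" "J u (c m, c m) = (\<Sum>k\<le>M. T k u (c m, c m))"
      by (rule J_upto[OF u]; use bounds in \<open>simp add: c_def M_def\<close>)+
    then have "J u (c m + x', c m + y') - J u (c m, c m) = (\<Sum>k\<le>M. T k u (c m + x', c m + y') - T k u (c m, c m))"
      by (simp add: sum_subtractf)
    also have "\<dots> = (\<Sum>k\<in>{m}. T k u (c m + x', c m + y') - T k u (c m, c m))"
      by (rule sum.mono_neutral_right) (use other \<open>m \<le> M\<close> in auto)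
    also have "\<dots> = h m * u (m, x', y')"
      using gridD(2)[OF blocksD[OF u]] by (simp add: T_def algebra_simps)
    also have "u (m, x', y') = u (m, x, y)"
      using grid_block_clamp[OF blocksD[OF u]] by (simp add: x'_def y'_def)
    finally show "R (J u) p = u p" using h[of m] by (simp add: R_def p x'_def y'_def)
  qed
  show ?thesis unfolding complemented_def
    by (intro exI[of _ J] exI[of _ R] conjI allI impI J R) (erule RJ)
qed

section \<open>Products of real sequences as weighted grids\<close>

text \<open>
  If \<open>\<alpha>\<close> maps the integers to the line so that distances are equivalent to sums of weights, then \<open>Lip\<^sub>0\<close> of
  the product of the image with itself is isomorphic to the grid space. The map \<open>\<alpha>\<close> may be constant where
  the weight vanishes; then so are the functions in the grid space, and the choice of a preimage does
  not matter.
\<close>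

lemma grid_iso_of_embedding:
  fixes \<alpha> :: "int \<Rightarrow> real" and w :: "int \<Rightarrow> real"
  assumes K: "0 \<le> K" "0 \<le> L"
    and lower: "\<And>i i'. i \<le> i' \<Longrightarrow> sum w {i..<i'} \<le> K * \<bar>\<alpha> i' - \<alpha> i\<bar>"
    and upper: "\<And>i. \<bar>\<alpha> (i + 1) - \<alpha> i\<bar> \<le> L * w i"
    and z: "z \<in> range \<alpha> \<times> range \<alpha>"
  shows "family_iso (lip_ball (submetric linf_plane (range \<alpha> \<times> range \<alpha>)) z) (grid w)"
proof -
  let ?M = "submetric linf_plane (range \<alpha> \<times> range \<alpha>)"
  define \<iota> where "\<iota> = inv \<alpha>"
  have \<alpha>\<iota>: "\<alpha> (\<iota> s) = s" if "s \<in> range \<alpha>" for s using that by (simp add: \<iota>_def f_inv_into_f)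
  define T :: "(real \<times> real \<Rightarrow> real) \<Rightarrow> int \<times> int \<Rightarrow> real" where
    "T f = (\<lambda>(i, j). f (\<alpha> i, \<alpha> j) - f (\<alpha> 0, \<alpha> 0))" for f
  define S :: "(int \<times> int \<Rightarrow> real) \<Rightarrow> real \<times> real \<Rightarrow> real" where
    "S g = (\<lambda>p. if p \<in> range \<alpha> \<times> range \<alpha> then g (\<iota> (fst p), \<iota> (snd p)) - g (\<iota> (fst z), \<iota> (snd z)) else 0)" for g
  have near: "\<bar>g (i, j) - g (i', j)\<bar> \<le> C * K * \<bar>\<alpha> i - \<alpha> i'\<bar>" if g: "grid w C g" for g C i i' j
  proof -
    have *: "\<bar>g (i', j) - g (i, j)\<bar> \<le> C * K * \<bar>\<alpha> i' - \<alpha> i\<bar>" if "i \<le> i'" for i i'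
    proof -
      have "C * sum w {i..<i'} \<le> C * (K * \<bar>\<alpha> i' - \<alpha> i\<bar>)"
        by (intro mult_left_mono lower that gridD(1)[OF g])
      then show ?thesis using grid_path(1)[OF g that, of j] by (simp add: mult.assoc)
    qed
    show ?thesis using *[of i i'] *[of i' i] by (cases "i \<le> i'") (auto simp: abs_minus_commute)
  qed
  have near2: "\<bar>g (i, j) - g (i', j')\<bar> \<le> C * K * (\<bar>\<alpha> i - \<alpha> i'\<bar> + \<bar>\<alpha> j - \<alpha> j'\<bar>)" if g: "grid w C g" for g C i i' j j'
  proof -
    have "\<bar>g (i', j) - g (i', j')\<bar> \<le> C * K * \<bar>\<alpha> j - \<alpha> j'\<bar>" using near[OF grid_swap[OF g], of j i' j'] by simp
    then show ?thesis using near[OF g, of i j i'] by (simp add: distrib_left)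
  qed
  have T: "bounded_op (lip_ball ?M z) (grid w) T"
  proof (rule bounded_opI[where K = L])
    fix x :: "int \<times> int"
    show "(\<lambda>f. T f x) \<in> finite_functionals"
      unfolding T_def case_prod_unfold by (intro finite_functional_intros)
  next
    fix C f assume f: "lip_ball ?M z C f"
    have C: "0 \<le> C" using f by (simp add: lip_ball_def)
    have lip: "\<bar>f (\<alpha> i, \<alpha> j) - f (\<alpha> i', \<alpha> j')\<bar> \<le> C * max \<bar>\<alpha> i - \<alpha> i'\<bar> \<bar>\<alpha> j - \<alpha> j'\<bar>" for i j i' j'
      using f unfolding lip_ball_def by (auto simp: mdist_linf_plane)
    have up: "C * \<bar>\<alpha> (i + 1) - \<alpha> i\<bar> \<le> L * C * w i" for i
      using mult_left_mono[OF upper C, of i] by (simp add: mult_ac)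
    show "grid w (L * C) (T f)"
    proof (rule gridI)
      fix i j
      show "\<bar>T f (i + 1, j) - T f (i, j)\<bar> \<le> L * C * w i"
        using lip[of "i + 1" j i j] up[of i] by (simp add: T_def)
      show "\<bar>T f (i, j + 1) - T f (i, j)\<bar> \<le> L * C * w j"
        using lip[of i "j + 1" i j] up[of j] by (simp add: T_def)
    qed (use C K in \<open>simp_all add: T_def\<close>)
  qed (rule K)
  have S: "bounded_op (grid w) (lip_ball ?M z) S"
  proof (rule bounded_opI[where K = "2 * K"])
    fix x :: "real \<times> real"
    show "(\<lambda>g. S g x) \<in> finite_functionals"
      unfolding S_def by (cases "x \<in> range \<alpha> \<times> range \<alpha>") (simp_all only: if_True if_False finite_functional_intros)
  next
    fix C g assume g: "grid w C g"
    have C: "0 \<le> C" by (rule gridD(1)[OF g])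
    have "\<bar>S g p - S g q\<bar> \<le> 2 * K * C * mdist linf_plane p q"
      if p: "p \<in> range \<alpha> \<times> range \<alpha>" and q: "q \<in> range \<alpha> \<times> range \<alpha>" for p q
    proof -
      obtain s t s' t' where pq: "p = (s, t)" "q = (s', t')" by fastforce
      have "\<bar>S g p - S g q\<bar> = \<bar>g (\<iota> s, \<iota> t) - g (\<iota> s', \<iota> t')\<bar>" using p q by (simp add: S_def pq)
      also have "\<dots> \<le> C * K * (\<bar>s - s'\<bar> + \<bar>t - t'\<bar>)"
        using near2[OF g, of "\<iota> s" "\<iota> t" "\<iota> s'" "\<iota> t'"] p q by (simp add: pq \<alpha>\<iota>)
      also have "\<dots> \<le> C * K * (2 * mdist linf_plane p q)"
      proof (rule mult_left_mono)
        show "\<bar>s - s'\<bar> + \<bar>t - t'\<bar> \<le> 2 * mdist linf_plane p q"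
          unfolding pq mdist_linf_plane
          using max.cobounded1[of "\<bar>s - s'\<bar>" "\<bar>t - t'\<bar>"] max.cobounded2[of "\<bar>t - t'\<bar>" "\<bar>s - s'\<bar>"] by argo
      qed (use C K in simp)
      finally show ?thesis by (simp add: mult_ac)
    qed
    then show "lip_ball ?M z (2 * K * C) (S g)"
      unfolding lip_ball_def using C K z by (auto simp: S_def)
  qed (use K in simp)
  have TS: "T (S g) = g" if g: "grid w C g" for C g
  proof
    fix p :: "int \<times> int"
    obtain i j where p: "p = (i, j)" by fastforce
    have "g (\<iota> (\<alpha> i), \<iota> (\<alpha> j)) = g (i, j)" for i j
      using near2[OF g, of "\<iota> (\<alpha> i)" "\<iota> (\<alpha> j)" i j] by (simp add: \<alpha>\<iota>)
    then show "T (S g) p = g p" using gridD(2)[OF g] by (simp add: T_def S_def p)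
  qed
  have ST: "S (T f) = f" if f: "lip_ball ?M z C f" for C f
  proof
    fix p show "S (T f) p = f p"
    proof (cases "p \<in> range \<alpha> \<times> range \<alpha>")
      case True
      have "(\<alpha> (\<iota> (fst q)), \<alpha> (\<iota> (snd q))) = q" if "q \<in> range \<alpha> \<times> range \<alpha>" for q
        using that by (cases q) (simp add: \<alpha>\<iota>)
      then show ?thesis using True z f by (simp add: S_def T_def lip_ball_def)
    next
      case False
      then have "f p = 0" using f unfolding lip_ball_def by (metis Int_UNIV_right mspace_linf_plane mspace_submetric)
      then show ?thesis using False by (simp add: S_def)
    qed
  qed
  show ?thesis unfolding family_iso_def
    by (intro exI[of _ T] exI[of _ S] conjI allI impI T S) (erule ST TS)+
qed

section \<open>The values of a polynomial\<close>

text \<open>The mean value theorem, applied with polynomial bounds for the derivative.\<close>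

lemma poly_forward_difference:
  fixes q :: "real poly"
  assumes q: "0 < degree q" "0 < lead_coeff q"
  obtains X L e where "0 < L"
    "\<And>x. X \<le> x \<Longrightarrow> 1 \<le> x \<Longrightarrow> L * x ^ e \<le> poly q (x + 1) - poly q x"
    "\<And>x. X \<le> x \<Longrightarrow> 1 \<le> x \<Longrightarrow> poly q (x + 1) - poly q x \<le> 4 * L * (x + 1) ^ e"
proof -
  define d where "d = pderiv q"
  define e where "e = degree d"
  define l where "l = lead_coeff d"
  have l: "0 < l" using q by (simp add: l_def d_def degree_pderiv coeff_pderiv)
  have "\<exists>n. \<forall>x\<ge>n. 0 < poly r x" if "coeff r e > 0" "degree r \<le> e" for r :: "real poly"
  proof -
    have "degree r = e" using that le_degree[of r e] by simp
    then show ?thesis using poly_pinfty_gt_lc[of r] that(1) by (metis less_le_trans)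
  qed
  note pos = this
  have "degree (d - monom (l / 2) e) \<le> e" "degree (monom (2 * l) e - d) \<le> e"
    by (auto intro!: degree_diff_le degree_monom_le simp: e_def)
  moreover have "coeff (d - monom (l / 2) e) e > 0" "coeff (monom (2 * l) e - d) e > 0"
    using l by (simp_all add: l_def e_def)
  ultimately obtain n1 n2 where "\<forall>x\<ge>n1. 0 < poly (d - monom (l / 2) e) x" "\<forall>x\<ge>n2. 0 < poly (monom (2 * l) e - d) x"
    using pos by meson
  then have n: "l / 2 * x ^ e \<le> poly d x" "poly d x \<le> 2 * l * x ^ e" if "max n1 n2 \<le> x" for x
    using that by (auto simp: poly_monom less_imp_le dest!: spec[of _ x])
  have bounds: "l / 2 * x ^ e \<le> poly q (x + 1) - poly q x" "poly q (x + 1) - poly q x \<le> 4 * (l / 2) * (x + 1) ^ e"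
    if x: "max n1 n2 \<le> x" "1 \<le> x" for x
  proof -
    obtain y where y: "x < y" "y < x + 1" "poly q (x + 1) - poly q x = poly d y"
      using poly_MVT[of x "x + 1" q] by (auto simp: d_def)
    have "l / 2 * x ^ e \<le> l / 2 * y ^ e" using y x l by (intro mult_left_mono power_mono) auto
    then show "l / 2 * x ^ e \<le> poly q (x + 1) - poly q x" using n(1)[of y] y x by simp
    have "2 * l * y ^ e \<le> 2 * l * (x + 1) ^ e" using y x l by (intro mult_left_mono power_mono) auto
    then show "poly q (x + 1) - poly q x \<le> 4 * (l / 2) * (x + 1) ^ e" using n(2)[of y] y x by simp
  qed
  show ?thesis by (rule that[of "l / 2" "max n1 n2" e]) (use l bounds in auto)
qed

text \<open>
  The values at the positive integers of a nonconstant polynomial with positive leading coefficient, in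
  increasing order. Small arguments may give values out of order or repeated, but from some \<open>N1\<close> on the
  polynomial is increasing on the integers and above all earlier values; so a sorted list of the finitely many earlier values is
  followed by the values at \<open>N1, N1 + 1, \<dots>\<close>.
\<close>

lemma poly_values_enumeration:
  fixes q :: "real poly"
  assumes q: "0 < degree q" "0 < lead_coeff q"
  obtains b :: "nat \<Rightarrow> real" and c K :: real where
    "range b = (\<lambda>n. poly q (real n)) ` {1..}" "0 < c" "\<And>i. c \<le> b (Suc i) - b i" "0 \<le> K"
    "\<And>n s0. \<exists>s\<ge>s0. \<exists>h>0. \<forall>i\<ge>s. i < s + n \<longrightarrow> h \<le> b (Suc i) - b i \<and> b (Suc i) - b i \<le> K * h"
proof -
  define v where "v n = poly q (real n)" for n :: nat
  obtain X L e where L: "0 < L"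
    and lower: "\<And>x. X \<le> x \<Longrightarrow> 1 \<le> x \<Longrightarrow> L * x ^ e \<le> poly q (x + 1) - poly q x"
    and upper: "\<And>x. X \<le> x \<Longrightarrow> 1 \<le> x \<Longrightarrow> poly q (x + 1) - poly q x \<le> 4 * L * (x + 1) ^ e"
    using poly_forward_difference[OF q] by metis
  define N where "N = nat \<lceil>max 1 X\<rceil>"
  have N: "X \<le> real n" "1 \<le> real n" if "N \<le> n" for n
  proof -
    have "max 1 X \<le> real N" unfolding N_def by (rule real_nat_ceiling_ge)
    then show "X \<le> real n" "1 \<le> real n" using that by auto
  qed
  have v_lower: "L * real n ^ e \<le> v (Suc n) - v n" and v_upper: "v (Suc n) - v n \<le> 4 * L * real (Suc n) ^ e"
    if "N \<le> n" for n
    using lower[OF N[OF that]] upper[OF N[OF that]] by (simp_all add: v_def add.commute)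
  have v_gap: "L \<le> v (Suc n) - v n" if "N \<le> n" for n
  proof -
    have "L * 1 \<le> L * real n ^ e" using L N(2)[OF that] by (intro mult_left_mono one_le_power) auto
    then show ?thesis using v_lower[OF that] by simp
  qed
  have v_grow: "v n + L * real k \<le> v (n + k)" if "N \<le> n" for n k
  proof (induction k)
    case (Suc k)
    then show ?case using v_gap[of "n + k"] that by (simp add: algebra_simps)
  qed simp
  define B where "B = Max (v ` {..N})"
  obtain k where k: "B - v N < real k * L" using reals_Archimedean3[OF L] by blast
  define N1 where "N1 = N + k"
  have N1: "1 \<le> N1" "N \<le> N1" using N(2)[of N] by (auto simp: N1_def)
  have below: "v m < v N1" if "m < N1" for m
  proof (cases "m \<le> N")
    case True
    then have "v m \<le> B" by (simp add: B_def)
    also have "B < v N1" using k v_grow[of N k] by (simp add: N1_def mult.commute)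
    finally show ?thesis .
  next
    case False
    have "0 < L * real (N1 - m)" using L that by simp
    then show ?thesis using v_grow[of m "N1 - m"] False that by simp
  qed
  define F where "F = v ` {1..<N1}"
  define xs where "xs = sorted_list_of_set F"
  have F: "finite F" by (simp add: F_def)
  have xs: "set xs = F" "sorted_wrt (<) xs" using F by (simp_all add: xs_def)
  define r where "r = length xs"
  define b where "b i = (if i < r then xs ! i else v (N1 + (i - r)))" for i
  have b_tail: "b (Suc i) - b i = v (Suc (N1 + (i - r))) - v (N1 + (i - r))" if "r \<le> i" for i
    using that by (simp add: b_def Suc_diff_le)
  have b_pos: "0 < b (Suc i) - b i" if "i < r" for i
  proof (cases "Suc i < r")
    case True
    then show ?thesis using sorted_wrt_nth_less[OF xs(2), of i "Suc i"] by (simp add: b_def r_def)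
  next
    case False
    then have "r = Suc i" using that by simp
    moreover have "xs ! i \<in> F" using that xs(1) nth_mem by (auto simp: r_def)
    then have "xs ! i < v N1" using below by (auto simp: F_def)
    ultimately show ?thesis by (simp add: b_def)
  qed
  have range_b: "range b = v ` {1..}"
  proof -
    have "{..<r} \<union> {r..} = (UNIV :: nat set)" by auto
    then have "range b = b ` {..<r} \<union> b ` {r..}" by (metis image_Un)
    also have "b ` {..<r} = F" using xs(1) by (auto simp: b_def r_def set_conv_nth image_iff)
    also have "b ` {r..} = v ` {N1..}"
    proof -
      have "n \<in> (\<lambda>i. N1 + (i - r)) ` {r..}" if "N1 \<le> n" for n
        using that by (intro image_eqI[of _ _ "r + (n - N1)"]) auto
      then have "(\<lambda>i. N1 + (i - r)) ` {r..} = {N1..}" by auto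
      moreover have "b ` {r..} = v ` (\<lambda>i. N1 + (i - r)) ` {r..}" by (auto simp: b_def image_image)
      ultimately show ?thesis by simp
    qed
    also have "F \<union> v ` {N1..} = v ` {1..}"
      unfolding F_def image_Un[symmetric] using N1 by (simp add: ivl_disj_un_one)
    finally show ?thesis .
  qed
  define c where "c = Min (insert L ((\<lambda>i. b (Suc i) - b i) ` {..<r}))"
  have c: "0 < c" using L b_pos by (simp add: c_def)
  have gap: "c \<le> b (Suc i) - b i" for i
  proof (cases "i < r")
    case True then show ?thesis unfolding c_def by (intro Min_le) auto
  next
    case False
    have "c \<le> L" unfolding c_def by (intro Min_le) auto
    also have "L \<le> v (Suc (N1 + (i - r))) - v (N1 + (i - r))" by (rule v_gap) (use N1 in simp)
    finally show ?thesis using b_tail[of i] False by simp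
  qed
  \<comment> \<open>The interval starts at an argument \<open>x\<close> at least as large as its length \<open>n\<close>, so that arguments at most double
    on it; this accounts for the factor \<open>2 ^ e\<close>.\<close>
  have slow: "\<exists>s\<ge>s0. \<exists>h>0. \<forall>i\<ge>s. i < s + n \<longrightarrow> h \<le> b (Suc i) - b i \<and> b (Suc i) - b i \<le> 4 * 2 ^ e * h" for n s0
  proof -
    define s where "s = s0 + (r + n)"
    define x where "x = N1 + (s - r)"
    have x: "1 \<le> x" "n \<le> x" "N \<le> x" using N1 by (auto simp: x_def s_def)
    define h where "h = L * real x ^ e"
    have "h \<le> b (Suc i) - b i \<and> b (Suc i) - b i \<le> 4 * 2 ^ e * h" if i: "s \<le> i" "i < s + n" for i
    proof -
      define y where "y = N1 + (i - r)"
      have y: "x \<le> y" "Suc y \<le> 2 * x" using i x by (auto simp: x_def y_def s_def)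
      have eq: "b (Suc i) - b i = v (Suc y) - v y" unfolding y_def by (rule b_tail) (use i in \<open>simp add: s_def\<close>)
      have "h \<le> L * real y ^ e" unfolding h_def using L y by (intro mult_left_mono power_mono) auto
      moreover have "4 * L * real (Suc y) ^ e \<le> 4 * L * (2 * real x) ^ e"
      proof (intro mult_left_mono power_mono)
        show "real (Suc y) \<le> 2 * real x" using y by linarith
      qed (use L in auto)
      moreover have "4 * L * (2 * real x) ^ e = 4 * 2 ^ e * h" by (simp add: h_def power_mult_distrib)
      moreover have "N \<le> y" using x y by simp
      ultimately show ?thesis unfolding eq using v_lower[OF \<open>N \<le> y\<close>] v_upper[OF \<open>N \<le> y\<close>] by linarith
    qed
    moreover have "0 < h" using L x by (simp add: h_def)
    moreover have "s0 \<le> s" by (simp add: s_def)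
    ultimately show ?thesis by blast
  qed
  show ?thesis
    by (rule that[OF _ c gap _ slow]) (use range_b in \<open>simp_all add: v_def\<close>)
qed

section \<open>Both free spaces\<close>

theorem slow_grid_iso_blocks:
  assumes w: "slow_weight w" and c: "complemented (grid w) (grid (\<lambda>_. 1))"
  shows "family_iso (grid w) blocks"
proof (rule pelczynski_decomposition[where \<sigma> = block_shift])
  show "ball_family (grid w)" using w by (intro ball_family_grid) (simp add: slow_weight_def)
  show "complemented (grid w) blocks"
    by (rule complemented_trans[OF c grid_complemented_in_blocks])
  show "complemented blocks (grid w)"
    by (rule blocks_complemented_in_grid[OF w])
qed (rule ball_family_blocks bij_block_shift blocks_shift)+

lemma slow_weight_1: "slow_weight (\<lambda>_. 1)"
  unfolding slow_weight_def
proof (intro conjI allI exI[of _ "1 :: real"])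
  fix n s0 :: nat
  show "\<exists>s\<ge>s0. \<exists>h>0. \<forall>i. int s \<le> i \<and> i < int (s + n) \<longrightarrow> h \<le> 1 \<and> 1 \<le> 1 * (h :: real)"
    by (rule exI[of _ s0], simp, rule exI[of _ "1 :: real"], simp)
qed simp_all

lemma complemented_refl: "complemented V V"
  unfolding complemented_def
  by (intro exI[of _ "\<lambda>f. f"] conjI bounded_op_id) simp

lemma integer_grid_iso_blocks:
  assumes "b \<in> \<int> \<times> \<int>"
  shows "family_iso (lip_ball (submetric linf_plane (\<int> \<times> \<int>)) b) blocks"
proof -
  have "family_iso (lip_ball (submetric linf_plane (range real_of_int \<times> range real_of_int)) b) (grid (\<lambda>_. 1))"
    using assms by (intro grid_iso_of_embedding[where K = 1 and L = 1]) (simp_all add: Ints_def)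
  then have "family_iso (lip_ball (submetric linf_plane (\<int> \<times> \<int>)) b) (grid (\<lambda>_. 1))"
    by (simp add: Ints_def)
  then show ?thesis
    using slow_grid_iso_blocks[OF slow_weight_1 complemented_refl] by (rule family_iso_trans)
qed

lemma poly_grid_iso_blocks:
  fixes p :: "real poly"
  assumes p: "0 < degree p" and a: "a \<in> poly_grid p"
  shows "family_iso (lip_ball (submetric linf_plane (poly_grid p)) a) blocks"
proof -
  \<comment> \<open>With this sign the leading coefficient becomes positive.\<close>
  define \<epsilon> where "\<epsilon> = sgn (lead_coeff p)"
  have "lead_coeff p \<noteq> 0" using p by auto
  then have \<epsilon>: "\<epsilon> * \<epsilon> = 1" "\<bar>\<epsilon>\<bar> = 1" "\<epsilon> * lead_coeff p > 0"
    by (cases "lead_coeff p" "0 :: real" rule: linorder_cases; simp add: \<epsilon>_def)+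
  have "0 < degree (smult \<epsilon> p)" "0 < lead_coeff (smult \<epsilon> p)" using p \<epsilon> by auto
  then obtain b c K where b: "range b = (\<lambda>n. poly (smult \<epsilon> p) (real n)) ` {1..}"
    and c: "0 < c" "\<And>i. c \<le> b (Suc i) - b i" and K: "0 \<le> K"
    and slow: "\<And>n s0. \<exists>s\<ge>s0. \<exists>h>0. \<forall>i\<ge>s. i < s + n \<longrightarrow> h \<le> b (Suc i) - b i \<and> b (Suc i) - b i \<le> K * h"
    by (rule poly_values_enumeration) (rule that)
  define \<alpha> where "\<alpha> i = \<epsilon> * b (nat i)" for i :: int
  define W where "W i = nat \<lceil>b (Suc i) - b i\<rceil>" for i
  let ?Q = "1 + 1 / c"
  have range_\<alpha>: "range \<alpha> = (\<lambda>n. poly p (real n)) ` {1..}"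
  proof -
    have "range nat = (UNIV :: nat set)" by (metis nat_int surjI)
    moreover have "range \<alpha> = (\<lambda>y. \<epsilon> * y) ` b ` range nat" by (simp add: \<alpha>_def image_image)
    ultimately have "range \<alpha> = (\<lambda>y. \<epsilon> * y) ` range b" by (simp only:)
    also have "\<dots> = (\<lambda>n. poly p (real n)) ` {1..}"
      unfolding b image_image by (simp add: mult.assoc[symmetric] \<epsilon>)
    finally show ?thesis .
  qed
  have grid_eq: "poly_grid p = range \<alpha> \<times> range \<alpha>"
    unfolding poly_grid_def range_\<alpha> by auto
  have W: "0 < W i" "b (Suc i) - b i \<le> W i" "W i \<le> ?Q * (b (Suc i) - b i)" for i
  proof -
    have g: "0 < b (Suc i) - b i" using c(2)[of i] c(1) by linarith
    show "0 < W i" using g by (simp add: W_def)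
    show "b (Suc i) - b i \<le> W i" unfolding W_def by (rule real_nat_ceiling_ge)
    have "real (W i) \<le> (b (Suc i) - b i) + 1" unfolding W_def using g by linarith
    moreover have "1 \<le> (b (Suc i) - b i) / c" using c by (simp add: le_divide_eq)
    ultimately show "W i \<le> ?Q * (b (Suc i) - b i)" by (simp add: distrib_right)
  qed
  have w_step: "b (nat (i + 1)) - b (nat i) \<le> weight W i" "weight W i \<le> ?Q * (b (nat (i + 1)) - b (nat i))" for i
  proof -
    have "b (nat (i + 1)) - b (nat i) \<le> weight W i \<and> weight W i \<le> ?Q * (b (nat (i + 1)) - b (nat i))"
    proof (cases "i < 0")
      case False
      then have "nat (i + 1) = Suc (nat i)" by simp
      then show ?thesis using W(2,3)[of "nat i"] False by (simp add: weight_def)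
    qed (simp add: weight_def)
    then show "b (nat (i + 1)) - b (nat i) \<le> weight W i" "weight W i \<le> ?Q * (b (nat (i + 1)) - b (nat i))"
      by blast+
  qed
  have Q: "0 \<le> ?Q" using c by simp
  have b_mono: "b (nat i) \<le> b (nat (i + 1))" for i
  proof (cases "i < 0")
    case False
    then have "nat (i + 1) = Suc (nat i)" by simp
    then show ?thesis using c(2)[of "nat i"] c(1) by simp
  qed simp
  have "family_iso (lip_ball (submetric linf_plane (range \<alpha> \<times> range \<alpha>)) a) (grid (weight W))"
  proof (rule grid_iso_of_embedding[where K = "1 + 1 / c" and L = 1])
    fix i i' :: int assume "i \<le> i'"
    then have "sum (weight W) {i..<i'} \<le> ?Q * (b (nat i') - b (nat i))"
    proof (induction i' rule: int_ge_induct)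
      case (step k)
      have "{i..<k + 1} = insert k {i..<k}" using step by auto
      then have "sum (weight W) {i..<k + 1} = weight W k + sum (weight W) {i..<k}" by simp
      then show ?case using step.IH w_step(2)[of k] by (simp add: right_diff_distrib)
    qed simp
    also have "\<dots> \<le> ?Q * \<bar>\<alpha> i' - \<alpha> i\<bar>"
      using Q by (intro mult_left_mono) (simp_all add: \<alpha>_def right_diff_distrib[symmetric] abs_mult \<epsilon>)
    finally show "sum (weight W) {i..<i'} \<le> ?Q * \<bar>\<alpha> i' - \<alpha> i\<bar>" .
  next
    fix i :: int
    show "\<bar>\<alpha> (i + 1) - \<alpha> i\<bar> \<le> 1 * weight W i"
      using w_step(1)[of i] b_mono[of i] by (simp add: \<alpha>_def right_diff_distrib[symmetric] abs_mult \<epsilon>)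
  qed (use Q a grid_eq in auto)
  moreover have "slow_weight (weight W)"
    unfolding slow_weight_def
  proof (intro conjI allI exI[of _ "?Q * K"])
    fix n s0
    obtain s h where s: "s0 \<le> s" "0 < h"
      "\<And>i. s \<le> i \<Longrightarrow> i < s + n \<Longrightarrow> h \<le> b (Suc i) - b i \<and> b (Suc i) - b i \<le> K * h"
      using slow by meson
    have "h \<le> weight W i \<and> weight W i \<le> ?Q * K * h" if i: "int s \<le> i" "i < int (s + n)" for i
    proof -
      have g: "h \<le> b (Suc (nat i)) - b (nat i)" "b (Suc (nat i)) - b (nat i) \<le> K * h"
        using s(3)[of "nat i"] i by auto
      have "?Q * (b (Suc (nat i)) - b (nat i)) \<le> ?Q * (K * h)" using g Q by (intro mult_left_mono) auto
      moreover have "weight W i = real (W (nat i))" using i by (simp add: weight_def)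
      ultimately show ?thesis using W(2,3)[of "nat i"] g(1) by (simp add: mult.assoc)
    qed
    then show "\<exists>s\<ge>s0. \<exists>h>0. \<forall>i. int s \<le> i \<and> i < int (s + n) \<longrightarrow> h \<le> weight W i \<and> weight W i \<le> ?Q * K * h"
      using s(1,2) by blast
  qed (use Q K in \<open>simp_all add: weight_def\<close>)
  then have "family_iso (grid (weight W)) blocks"
    by (rule slow_grid_iso_blocks) (rule weighted_grid_complemented[OF W(1)])
  ultimately show ?thesis unfolding grid_eq by (rule family_iso_trans)
qed

theorem corollary19:
  fixes p :: "real poly" and a b :: "real \<times> real"
  assumes "degree p > 0"
    and "a \<in> poly_grid p" and "b \<in> \<int> \<times> \<int>"
  shows "lipschitz_free_space (submetric linf_plane (poly_grid p)) a
           \<sim>\<^sub>B lipschitz_free_space (submetric linf_plane (\<int> \<times> \<int>)) b"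
proof (rule free_space_iso)
  show "family_iso (lip_ball (submetric linf_plane (poly_grid p)) a)
      (lip_ball (submetric linf_plane (\<int> \<times> \<int>)) b)"
    using poly_grid_iso_blocks[OF assms(1,2)] family_iso_sym[OF integer_grid_iso_blocks[OF assms(3)]]
    by (rule family_iso_trans)
qed (use assms(2,3) in simp_all)

end
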